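(* Let $\epsilon\in\mathbb Z$, let $V$ be a vertex algebra and let $(W,Y_W^\epsilon)$ be a $\phi_\epsilon$-coordinated $V$-module. Then for all $u,v\in V$, $$Y_W^\epsilon(u_{-1}v,z)={}_\circ^\circ Y_W^\epsilon(u,z)Y_W^\epsilon(v,z){}_\circ^\circ-\sum_{n\ge0}\sum_{i=0}^{n+1}\frac1{i!}\,\epsilon^{(i)}\,h_{n-i+1}\,z^{(n+1)(\epsilon-1)}\,Y_W^\epsilon(u_nv,z),$$ where $\epsilon^{(m)}=\prod_{s=0}^{m-1}(\epsilon+s(\epsilon-1))$ for $m\ge 0$, $h_0=1$ and, for $n\ge1$, $$h_n=\sum_{\substack{r_1,\dots,r_n\ge0\\ r_1+2r_2+\cdots+nr_n=n}}(-1)^{\sum_{m=1}^nr_m}\Big(\sum_{m=1}^nr_m\Big)!\prod_{m=1}^n\frac1{r_m!}\Big(\frac{\epsilon^{(m)}}{(m+1)!}\Big)^{r_m}.$$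
   Context: A vertex algebra is $V=(V,Y,\mathbf 1)$ over $\mathbb C$ with $Y(v,z)=\sum_{n\in\mathbb Z}v_nz^{-n-1}$. For $\epsilon\in\mathbb Z$ set $\phi_\epsilon(z_2,z_0)=e^{z_0(z_2^\epsilon\frac{d}{dz_2})}z_2\in\mathbb C((z_2))[[z_0]]$. A $\phi_\epsilon$-coordinated $V$-module $(W,Y_W^\epsilon)$ is a vector space $W$ with a linear map $Y_W^\epsilon(\cdot,z):V\to\mathrm{Hom}(W,W((z)))$ such that $Y_W^\epsilon(\mathbf 1,z)=1_W$ and for all $u,v\in V$ there is $k\in\mathbb Z_{\ge 0}$ with $(z_1-z_2)^kY_W^\epsilon(u,z_1)Y_W^\epsilon(v,z_2)\in\mathrm{Hom}(W,W((z_1,z_2)))$ and $(\phi_\epsilon(z_2,z_0)-z_2)^kY_W^\epsilon(Y(u,z_0)v,z_2)=\big((z_1-z_2)^kY_W^\epsilon(u,z_1)Y_W^\epsilon(v,z_2)\big)|_{z_1=\phi_\epsilon(z_2,z_0)}$. Normally ordered product: for formal series $a(z)=\sum_na_nz^{-n-1}$, $b(z)$ with operator coefficients, ${}_\circ^\circ a(z)b(z){}_\circ^\circ=a^+(z)b(z)+b(z)a^-(z)$ with $a^+(z)=\sum_{n<0}a_nz^{-n-1}$ and $a^-(z)=\sum_{n\ge0}a_nz^{-n-1}$. *)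

theory Defs
  imports
    Complex_Main
    "HOL-Library.FuncSet"
    "HOL-Library.Groups_Big_Fun"
    "HOL-Computational_Algebra.Formal_Laurent_Series"
begin

text \<open>
  A field \<open>a(z) = \<Sum>n. a\<^sub>n z\<^bsup>-n-1\<^esup>\<close> with operator coefficients is represented by its modes
  \<open>n \<mapsto> a\<^sub>n\<close>. A series in two variables is represented by its coefficients: \<open>F a b\<close> is the
  coefficient of the first variable to the power \<open>a\<close> times the second to the power \<open>b\<close>.
  \<^const>\<open>Sum_any\<close> is the sum over the support of a function. All its uses below have finite
  support, by the truncation conditions.
\<close>

text \<open>
  The Jacobi identity is stated through its coefficients: \<open>jacobi\<close> is the coefficient of
  \<open>z\<^sub>0\<^bsup>-l-1\<^esup> z\<^sub>1\<^bsup>-m-1\<^esup> z\<^sub>2\<^bsup>-n-1\<^esup>\<close> in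
  \<open>z\<^sub>0\<^bsup>-1\<^esup> \<delta>((z\<^sub>1 - z\<^sub>2)/z\<^sub>0) Y(u,z\<^sub>1) Y(v,z\<^sub>2) - z\<^sub>0\<^bsup>-1\<^esup> \<delta>((z\<^sub>2 - z\<^sub>1)/(-z\<^sub>0)) Y(v,z\<^sub>2) Y(u,z\<^sub>1)
    = z\<^sub>2\<^bsup>-1\<^esup> \<delta>((z\<^sub>1 - z\<^sub>0)/z\<^sub>2) Y(Y(u,z\<^sub>0)v,z\<^sub>2)\<close>,
  applied to \<open>w\<close>.
\<close>

locale vertex_algebra = vector_space scale
  for scale :: "complex \<Rightarrow> 'v::ab_group_add \<Rightarrow> 'v" +
  fixes Y :: "'v \<Rightarrow> int \<Rightarrow> 'v \<Rightarrow> 'v"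
    and vac :: 'v
  assumes linear_state: "Vector_Spaces.linear scale scale (\<lambda>u. Y u n v)"
    and linear_mode: "Vector_Spaces.linear scale scale (Y u n)"
    and truncation: "\<exists>N. \<forall>n\<ge>N. Y u n v = 0"
    and vacuum: "Y vac n v = (if n = -1 then v else 0)"
    and creation: "n \<ge> 0 \<Longrightarrow> Y v n vac = 0" "Y v (-1) vac = v"
    and jacobi:
      "Sum_any (\<lambda>i::nat. scale ((-1) ^ i * (of_int l gchoose i)) (Y u (m + l - int i) (Y v (n + int i) w)))
       - Sum_any (\<lambda>i::nat. scale ((-1) ^ i * (of_int l gchoose i) * (-1) powi l)
           (Y v (n + l - int i) (Y u (m + int i) w)))
       = Sum_any (\<lambda>i::nat. scale (of_int m gchoose i) (Y (Y u (l + int i) v) (m + n - int i) w))"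

text \<open>
  The ring \<open>\<complex>((z\<^sub>2))[[z\<^sub>0]]\<close> is the type \<^typ>\<open>complex fls fps\<close>. Since \<^typ>\<open>complex fls\<close> is a field,
  a series with nonzero constant term in \<open>z\<^sub>0\<close>, such as \<open>\<phi>\<^sub>\<epsilon>\<close>, is invertible in it.
\<close>

definition phi :: "int \<Rightarrow> complex fls fps" where
  "phi \<epsilon> = Abs_fps (\<lambda>n. fls_const (1 / fact n) * ((\<lambda>f. fls_X_intpow \<epsilon> * fls_deriv f) ^^ n) fls_X)"

text \<open>The coefficient of \<open>z\<^sub>0\<^bsup>j\<^esup> z\<^sub>2\<^bsup>m\<^esup>\<close>.\<close>

definition coeff02 :: "complex fls fps \<Rightarrow> int \<Rightarrow> int \<Rightarrow> complex" where
  "coeff02 f j m = (if j < 0 then 0 else fls_nth (fps_nth f (nat j)) m)"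

text \<open>The product of \<open>f \<in> \<complex>((z\<^sub>2))[[z\<^sub>0]]\<close> with a series in \<open>z\<^sub>0, z\<^sub>2\<close> with vector coefficients.\<close>

definition times02 ::
  "(complex \<Rightarrow> 'w::ab_group_add \<Rightarrow> 'w) \<Rightarrow> complex fls fps \<Rightarrow> (int \<Rightarrow> int \<Rightarrow> 'w) \<Rightarrow> int \<Rightarrow> int \<Rightarrow> 'w" where
  "times02 scale f S j m = Sum_any (\<lambda>(i, b). scale (coeff02 f i b) (S (j - i) (m - b)))"

text \<open>
  The substitution \<open>F(\<phi>\<^sub>\<epsilon>(z\<^sub>2,z\<^sub>0), z\<^sub>2)\<close> for \<open>F(z\<^sub>1,z\<^sub>2) \<in> W((z\<^sub>1,z\<^sub>2))\<close>, that is,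
  \<open>\<Sum>a b. F\<^sub>a\<^sub>b \<phi>\<^sub>\<epsilon>(z\<^sub>2,z\<^sub>0)\<^bsup>a\<^esup> z\<^sub>2\<^bsup>b\<^esup>\<close>, as a series in \<open>z\<^sub>0, z\<^sub>2\<close>.
\<close>

definition subst_phi ::
  "(complex \<Rightarrow> 'w::ab_group_add \<Rightarrow> 'w) \<Rightarrow> int \<Rightarrow> (int \<Rightarrow> int \<Rightarrow> 'w) \<Rightarrow> int \<Rightarrow> int \<Rightarrow> 'w" where
  "subst_phi scale \<epsilon> F j m = Sum_any (\<lambda>(a, b). scale (coeff02 (phi \<epsilon> powi a) j (m - b)) (F a b))"

text \<open>Membership in \<open>W((z\<^sub>1,z\<^sub>2)) = W[[z\<^sub>1,z\<^sub>2]][z\<^sub>1\<^bsup>-1\<^esup>,z\<^sub>2\<^bsup>-1\<^esup>]\<close>.\<close>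

definition laurent2 :: "(int \<Rightarrow> int \<Rightarrow> 'w::zero) \<Rightarrow> bool" where
  "laurent2 F \<longleftrightarrow> (\<exists>N. \<forall>a b. a < N \<or> b < N \<longrightarrow> F a b = 0)"

definition times_z1_minus_z2 :: "(int \<Rightarrow> int \<Rightarrow> 'w::ab_group_add) \<Rightarrow> int \<Rightarrow> int \<Rightarrow> 'w" where
  "times_z1_minus_z2 F a b = F (a - 1) b - F a (b - 1)"

text \<open>\<open>a(z\<^sub>1) b(z\<^sub>2) w\<close> as a series in \<open>z\<^sub>1, z\<^sub>2\<close>.\<close>

definition prod12 :: "(int \<Rightarrow> 'w \<Rightarrow> 'w) \<Rightarrow> (int \<Rightarrow> 'w \<Rightarrow> 'w) \<Rightarrow> 'w \<Rightarrow> int \<Rightarrow> int \<Rightarrow> 'w" where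
  "prod12 a b w p q = a (- p - 1) (b (- q - 1) w)"

locale phi_coordinated_module =
  V: vertex_algebra scaleV Y vac + W: vector_space scaleW
  for scaleV :: "complex \<Rightarrow> 'v::ab_group_add \<Rightarrow> 'v"
    and Y :: "'v \<Rightarrow> int \<Rightarrow> 'v \<Rightarrow> 'v"
    and vac :: 'v
    and scaleW :: "complex \<Rightarrow> 'w::ab_group_add \<Rightarrow> 'w" +
  fixes \<epsilon> :: int
    and YW :: "'v \<Rightarrow> int \<Rightarrow> 'w \<Rightarrow> 'w"
  assumes linear_state: "Vector_Spaces.linear scaleV scaleW (\<lambda>v. YW v n w)"
    and linear_mode: "Vector_Spaces.linear scaleW scaleW (YW v n)"
    and truncation: "\<exists>N. \<forall>n\<ge>N. YW v n w = 0"
    and vacuum: "YW vac n w = (if n = -1 then w else 0)"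
    and weak_assoc: "\<exists>k::nat.
      (\<forall>w. laurent2 ((times_z1_minus_z2 ^^ k) (prod12 (YW u) (YW v) w))) \<and>
      (\<forall>w. times02 scaleW ((phi \<epsilon> - fps_const fls_X) ^ k)
              (\<lambda>j m. YW (Y u (- j - 1) v) (- m - 1) w)
            = subst_phi scaleW \<epsilon> ((times_z1_minus_z2 ^^ k) (prod12 (YW u) (YW v) w)))"

definition plus_part :: "(int \<Rightarrow> 'w \<Rightarrow> 'w::zero) \<Rightarrow> int \<Rightarrow> 'w \<Rightarrow> 'w" where
  "plus_part a n w = (if n < 0 then a n w else 0)"

definition minus_part :: "(int \<Rightarrow> 'w \<Rightarrow> 'w::zero) \<Rightarrow> int \<Rightarrow> 'w \<Rightarrow> 'w" where
  "minus_part a n w = (if n \<ge> 0 then a n w else 0)"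

text \<open>As \<open>z\<^bsup>-n-1\<^esup> z\<^bsup>-l-1\<^esup> = z\<^bsup>-m-1\<^esup>\<close> for \<open>l = m - n - 1\<close>, the mode \<open>m\<close> of \<open>a(z) b(z)\<close> is:\<close>

definition field_mult :: "(int \<Rightarrow> 'w \<Rightarrow> 'w) \<Rightarrow> (int \<Rightarrow> 'w \<Rightarrow> 'w) \<Rightarrow> int \<Rightarrow> 'w \<Rightarrow> 'w::ab_group_add" where
  "field_mult a b m w = Sum_any (\<lambda>n. a n (b (m - n - 1) w))"

definition normal_ordered :: "(int \<Rightarrow> 'w \<Rightarrow> 'w) \<Rightarrow> (int \<Rightarrow> 'w \<Rightarrow> 'w) \<Rightarrow> int \<Rightarrow> 'w \<Rightarrow> 'w::ab_group_add" where
  "normal_ordered a b m w = field_mult (plus_part a) b m w + field_mult b (minus_part a) m w"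

definition zpow_mult :: "int \<Rightarrow> (int \<Rightarrow> 'w \<Rightarrow> 'w) \<Rightarrow> int \<Rightarrow> 'w \<Rightarrow> 'w" where
  "zpow_mult p a m w = a (m + p) w"

definition eps_prod :: "int \<Rightarrow> nat \<Rightarrow> complex" where
  "eps_prod \<epsilon> m = (\<Prod>s<m. of_int (\<epsilon> + int s * (\<epsilon> - 1)))"

text \<open>
  With \<open>x = z\<^sub>0 z\<^sub>2\<^bsup>\<epsilon>-1\<^esup>\<close>, one has
  \<open>\<phi>\<^sub>\<epsilon>(z\<^sub>2,z\<^sub>0) - z\<^sub>2 = z\<^sub>2 x (\<Sum>m\<ge>0. eps_prod \<epsilon> m / (m+1)! x\<^bsup>m\<^esup>)\<close>, and the numbers
  \<open>h_coeff \<epsilon> n\<close> are the coefficients of the inverse of the series in parentheses. The exponents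
  \<open>r\<^sub>1, \<dots>, r\<^sub>n\<close> form an extensional function on \<open>{1..n}\<close>, so the index set is finite.
\<close>

definition h_coeff :: "int \<Rightarrow> nat \<Rightarrow> complex" where
  "h_coeff \<epsilon> n = (if n = 0 then 1 else
     (\<Sum>r \<in> {r \<in> {1..n} \<rightarrow>\<^sub>E (UNIV :: nat set). (\<Sum>m=1..n. m * r m) = n}.
        (-1) ^ (\<Sum>m=1..n. r m) * fact (\<Sum>m=1..n. r m) *
        (\<Prod>m=1..n. 1 / fact (r m) * (eps_prod \<epsilon> m / fact (m + 1)) ^ r m)))"

end

theory Submission
  imports Defs
begin

text \<open>
  The proof replaces operators by numbers. For a linear functional \<open>L\<close> on \<open>W\<close>, a vector \<open>w\<close> and a
  total degree \<open>c\<close>, every two-variable series in the definition of a module becomes homogeneous, hence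
  a series in the single variable \<open>x = z\<^sub>0 z\<^sub>2\<^bsup>d\<^esup>\<close> with \<open>d = \<epsilon> - 1\<close>. In this variable
  \<open>\<phi>\<^sub>\<epsilon> = z\<^sub>2 g(x)\<close>, and \<open>\<phi>\<^sub>\<epsilon>\<^bsup>a\<^esup> = z\<^sub>2\<^bsup>a\<^esup> g(x)\<^bsup>a\<^esup>\<close> where
  \<open>g\<^bsup>a\<^esup> = (1 - d x)\<^bsup>-a/d\<^esup>\<close> is \<open>gpow d a\<close> (for \<open>d = 0\<close> it is \<open>exp (a x)\<close>). Let \<open>A(x)\<close> be the
  Laurent series of the iterates \<open>u\<^sub>n v\<close> and \<open>X\<^sub>p\<close> the coefficients of \<open>Y(u,z\<^sub>1) Y(v,z\<^sub>2)\<close> in degree \<open>c\<close>.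
  Multiplication by \<open>z\<^sub>1 - z\<^sub>2\<close> acts on \<open>X\<close> as a difference operator \<open>D\<close>, and weak associativity
  reads
    \<open>(g - 1)\<^bsup>k\<^esup> A = \<Sum>a. (D\<^bsup>k\<^esup> X)\<^sub>a g\<^bsup>a\<^esup>\<close>, a finite sum.

  The formula is the evaluation of the residue of \<open>g' / (g - 1) A\<close> in two ways.
  Writing \<open>g - 1 = x p(x)\<close>, its coefficient expansion is \<open>\<Sum>n. [x\<^bsup>n\<^esup>] (g' / p) A\<^sub>-\<^sub>n\<close>. As
  \<open>g' = g\<^bsup>\<epsilon>\<^esup> = \<Sum>i. eps_prod \<epsilon> i / i! x\<^bsup>i\<^esup>\<close> and \<open>1 / p\<close> has the coefficients \<open>h_coeff \<epsilon>\<close>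
  (\<open>h_coeff_eq\<close>), the term \<open>n = 0\<close> is the mode of \<open>u\<^sub>-\<^sub>1 v\<close> and the others form the correction sum.
  On the other hand, the change of variable \<open>y = g(x) - 1\<close> shows that the residue of
  \<open>g' (g - 1)\<^bsup>-k-1\<^esup> g\<^bsup>a\<^esup>\<close> is the binomial coefficient of \<open>a\<close> over \<open>k\<close> (\<open>residue_gpow\<close>), so the
  residue is \<open>\<Sum>a. (D\<^bsup>k\<^esup> X)\<^sub>a (a choose k)\<close>. Summation by parts (\<open>Sum_any_splice\<close>) turns this into
  \<open>\<Sum>p\<ge>0. X\<^sub>p + \<Sum>p<0. Z\<^sub>p\<close>, which is the normally ordered product; here \<open>Z\<close> belongs to the product in the
  opposite order, and the step needs \<open>D\<^bsup>k\<^esup> X = D\<^bsup>k\<^esup> Z\<close>.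

  That locality is not an axiom and is derived in \<open>locality\<close>. Weak associativity with the vacuum gives
  \<open>Y(e\<^bsup>z\<^sub>0 T\<^esup> u, z) = Y(u, \<phi>\<^sub>\<epsilon>(z,z\<^sub>0))\<close> on matrix coefficients (\<open>iterate_vacuum\<close>), where \<open>T a = a\<^sub>-\<^sub>2 vac\<close>
  is the translation operator. Together with
  skew-symmetry in \<open>V\<close> this yields \<open>A = g\<^bsup>c\<^esup> B(- x g\<^bsup>d\<^esup>)\<close> for the iterates \<open>B\<close> with \<open>u\<close> and \<open>v\<close>
  exchanged (\<open>iterate_series_skew\<close>). The substitution \<open>x \<mapsto> - x g\<^bsup>d\<^esup>\<close> sends \<open>g\<close> to \<open>1/g\<close>, so weak
  associativity for \<open>(v, u)\<close> becomes an expansion of \<open>(g - 1)\<^bsup>k\<^esup> A\<close> with coefficients \<open>D\<^bsup>k\<^esup> Z\<close>; the powers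
  of \<open>g\<close> are linearly independent (\<open>gpow_independent\<close>), and the two expansions agree.
\<close>



section \<open>Powers of the coordinate series\<close>

text \<open>
  The power \<open>g\<^bsup>a\<^esup>\<close> of the series \<open>g = gpow d 1\<close>, as a series in \<open>x\<close>. The coefficients arise from
  \<open>(z\<^bsup>d+1\<^esup> d/dz)\<^bsup>j\<^esup> z\<^bsup>a\<^esup> = (\<Prod>s<j. a + s d) z\<^bsup>a + j d\<^esup>\<close>. The parameter \<open>d\<close> stands for \<open>\<epsilon> - 1\<close>.
\<close>

definition gpow :: "complex \<Rightarrow> complex \<Rightarrow> complex fps" where
  "gpow d a = Abs_fps (\<lambda>j. (\<Prod>s<j. a + of_nat s * d) / fact j)"

lemma gpow_nth_0 [simp]: "fps_nth (gpow d a) 0 = 1"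
  by (simp add: gpow_def)

lemma gpow_nth_Suc:
  "of_nat (Suc j) * fps_nth (gpow d a) (Suc j) = (a + of_nat j * d) * fps_nth (gpow d a) j"
  by (simp add: gpow_def del: of_nat_Suc)

text \<open>
  This equation characterises the series of constant term 1 (\<open>ode_unique\<close>), so that the multiplicative
  properties of powers and the behaviour under substitution reduce to computations of derivatives.
\<close>

lemma gpow_ode: "(1 - fps_const d * fps_X) * fps_deriv (gpow d a) = fps_const a * gpow d a"
proof (rule fps_ext)
  fix n
  show "fps_nth ((1 - fps_const d * fps_X) * fps_deriv (gpow d a)) n = fps_nth (fps_const a * gpow d a) n"
  proof (cases n)
    case 0
    then show ?thesis using gpow_nth_Suc[of 0 d a] by (simp add: algebra_simps)
  next
    case (Suc m)
    have "fps_nth ((1 - fps_const d * fps_X) * fps_deriv (gpow d a)) (Suc m)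
       = of_nat (Suc (Suc m)) * fps_nth (gpow d a) (Suc (Suc m)) - d * (of_nat (Suc m) * fps_nth (gpow d a) (Suc m))"
      by (simp add: left_diff_distrib mult.assoc)
    also have "\<dots> = a * fps_nth (gpow d a) (Suc m)"
      by (subst gpow_nth_Suc) (simp add: algebra_simps)
    finally show ?thesis using Suc by simp
  qed
qed

lemma ode_unique:
  assumes "(1 - fps_const d * fps_X) * fps_deriv f = fps_const a * f" "fps_nth f 0 = 1"
  shows "f = gpow d a"
proof (rule fps_ext)
  fix n
  show "fps_nth f n = fps_nth (gpow d a) n"
  proof (induction n)
    case 0
    then show ?case using assms by simp
  next
    case (Suc n)
    have "of_nat (Suc n) * fps_nth f (Suc n) = (a + of_nat n * d) * fps_nth f n"
    proof (cases n)
      case 0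
      then show ?thesis using arg_cong[OF assms(1), of "\<lambda>f. fps_nth f 0"] by simp
    next
      case (Suc m)
      have "fps_nth ((1 - fps_const d * fps_X) * fps_deriv f) n
          = of_nat (Suc n) * fps_nth f (Suc n) - d * (of_nat n * fps_nth f n)"
        by (simp add: left_diff_distrib mult.assoc Suc)
      then show ?thesis unfolding assms(1) by (simp add: algebra_simps)
    qed
    with gpow_nth_Suc[of n d a] Suc.IH
    have "of_nat (Suc n) * fps_nth f (Suc n) = of_nat (Suc n) * fps_nth (gpow d a) (Suc n)"
      by simp
    then show ?case by (simp only: mult_cancel_left of_nat_eq_0_iff) simp
  qed
qed

lemma gpow_add: "gpow d a * gpow d b = gpow d (a + b)"
proof (rule ode_unique)
  have "(1 - fps_const d * fps_X) * fps_deriv (gpow d a * gpow d b)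
      = ((1 - fps_const d * fps_X) * fps_deriv (gpow d a)) * gpow d b
        + gpow d a * ((1 - fps_const d * fps_X) * fps_deriv (gpow d b))"
    by (simp add: algebra_simps)
  also have "\<dots> = fps_const (a + b) * (gpow d a * gpow d b)"
    unfolding gpow_ode by (simp add: algebra_simps flip: fps_const_add)
  finally show "(1 - fps_const d * fps_X) * fps_deriv (gpow d a * gpow d b)
     = fps_const (a + b) * (gpow d a * gpow d b)" .
qed simp

lemma gpow_0 [simp]: "gpow d 0 = 1"
  by (rule sym, rule ode_unique) simp_all

lemma gpow_power: "gpow d a ^ k = gpow d (of_nat k * a)"
  by (induction k) (simp_all add: gpow_add algebra_simps)

lemma gpow_nonzero [simp]: "gpow d a \<noteq> 0"
  using gpow_nth_0[of d a] by (metis fps_zero_nth zero_neq_one)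

lemma gpow_uminus_d: "gpow d (- d) = 1 - fps_const d * fps_X"
  by (rule sym, rule ode_unique) (simp_all add: algebra_simps)

lemma gpow_deriv: "fps_deriv (gpow d a) = fps_const a * gpow d (a + d)"
proof -
  have "fps_deriv (gpow d a) = gpow d d * (gpow d (- d) * fps_deriv (gpow d a))"
    by (simp add: gpow_add flip: mult.assoc)
  also have "\<dots> = gpow d d * (fps_const a * gpow d a)"
    by (simp only: gpow_uminus_d gpow_ode)
  also have "\<dots> = fps_const a * gpow d (a + d)"
    by (simp add: gpow_add mult.left_commute add.commute)
  finally show ?thesis .
qed

text \<open>
  The substitution corresponds to exchanging the roles of \<open>z\<^sub>2\<close> and \<open>z\<^sub>1 = \<phi>\<^sub>\<epsilon>(z\<^sub>2,z\<^sub>0)\<close>: the flow of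
  \<open>z\<^bsup>\<epsilon>\<^esup> d/dz\<close> is run backwards from \<open>z\<^sub>1\<close>, so \<open>x = z\<^sub>0 z\<^sub>2\<^bsup>d\<^esup>\<close> is replaced by
  \<open>- z\<^sub>0 z\<^sub>1\<^bsup>d\<^esup> = - x g\<^bsup>d\<^esup>\<close> and \<open>g = z\<^sub>1/z\<^sub>2\<close> by its inverse. With \<open>g\<^bsup>-d\<^esup> = 1 - d x\<close>, the
  composite satisfies the differential equation for the exponent \<open>-a\<close>.
\<close>

lemma gpow_compose: "gpow d a oo (- (fps_X * gpow d d)) = gpow d (- a)"
proof -
  define y where "y = - (fps_X * gpow d d)"
  have y0: "fps_nth y 0 = 0" by (simp add: y_def)
  have dX: "fps_const d * fps_X = 1 - gpow d (- d)" by (simp add: gpow_uminus_d)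
  have one: "gpow d d * gpow d (- d) = 1" by (simp add: gpow_add)
  have "fps_deriv y = - gpow d d - (fps_const d * fps_X) * (gpow d d * gpow d d)"
    by (simp add: y_def gpow_deriv gpow_add algebra_simps)
  also have "\<dots> = - (gpow d d * gpow d d)"
    unfolding dX using one by algebra
  finally have y': "fps_deriv y = - (gpow d d * gpow d d)" .
  have "1 - fps_const d * y = 1 + (fps_const d * fps_X) * gpow d d"
    by (simp add: y_def algebra_simps)
  also have "\<dots> = gpow d d"
    unfolding dX using one by algebra
  finally have ly: "1 - fps_const d * y = gpow d d" .
  have "((1 - fps_const d * fps_X) * fps_deriv (gpow d a)) oo y = (fps_const a * gpow d a) oo y"
    by (simp only: gpow_ode)
  then have *: "gpow d d * (fps_deriv (gpow d a) oo y) = fps_const a * (gpow d a oo y)"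
    by (simp add: fps_compose_mult_distrib[OF y0] fps_compose_sub_distrib fps_const_compose y0 ly)
  have "gpow d a oo y = gpow d (- a)"
  proof (rule ode_unique)
    have "fps_deriv (gpow d a oo y) = - ((gpow d d * (fps_deriv (gpow d a) oo y)) * gpow d d)"
      by (simp add: fps_compose_deriv[OF y0] y' algebra_simps)
    also have "\<dots> = - (fps_const a * (gpow d a oo y) * gpow d d)" unfolding * ..
    finally have "(1 - fps_const d * fps_X) * fps_deriv (gpow d a oo y)
        = - (fps_const a * (gpow d a oo y) * (gpow d d * gpow d (- d)))"
      by (simp add: gpow_uminus_d mult.assoc mult.left_commute mult.commute)
    then show "(1 - fps_const d * fps_X) * fps_deriv (gpow d a oo y)
        = fps_const (- a) * (gpow d a oo y)" unfolding one by (simp flip: fps_const_neg)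
  qed simp
  then show ?thesis by (simp add: y_def)
qed

text \<open>
  The \<open>r\<close>th power of the substituted series is \<open>(-1)\<^bsup>r\<^esup> x\<^bsup>r\<^esup> g\<^bsup>r d\<^esup>\<close>, a monomial times a power of \<open>g\<close>.
\<close>

lemma gpow_mult_compose_nth:
  "fps_nth (gpow d e * (F oo (- (fps_X * gpow d d)))) m
     = (\<Sum>r=0..m. (-1) ^ r * fps_nth F r * fps_nth (gpow d (e + of_nat r * d)) (m - r))"
proof -
  define H where "H = - (fps_X * gpow d d)"
  have H0: "fps_nth H 0 = 0" by (simp add: H_def)
  have gH: "gpow d e * H ^ r = fps_const ((-1) ^ r) * (fps_X ^ r * gpow d (e + of_nat r * d))" for r
  proof -
    have "gpow d e * H ^ r = (- fps_X) ^ r * (gpow d e * gpow d d ^ r)"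
      by (simp only: H_def power_mult_distrib mult.left_commute mult_minus_left[symmetric])
    also have "(- fps_X :: complex fps) ^ r = fps_const ((-1) ^ r) * fps_X ^ r"
      by (metis fps_const_power fps_const_neg fps_const_1_eq_1 power_minus)
    finally show ?thesis by (simp add: gpow_power gpow_add mult.assoc)
  qed
  have comp: "fps_nth (F oo H) n = (\<Sum>i=0..m. fps_nth F i * fps_nth (H ^ i) n)" if "n \<le> m" for n
    unfolding fps_compose_nth using that
    by (intro sum.mono_neutral_left) (auto simp: startsby_zero_power_prefix[OF H0])
  have "fps_nth (gpow d e * (F oo H)) m
      = (\<Sum>l=0..m. fps_nth (gpow d e) l * (\<Sum>i=0..m. fps_nth F i * fps_nth (H ^ i) (m - l)))"
    unfolding fps_mult_nth by (intro sum.cong refl) (simp add: comp)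
  also have "\<dots> = (\<Sum>i=0..m. fps_nth F i * fps_nth (gpow d e * H ^ i) m)"
    unfolding fps_mult_nth sum_distrib_left by (subst sum.swap) (simp add: mult.left_commute)
  also have "\<dots> = (\<Sum>r=0..m. (-1) ^ r * fps_nth F r * fps_nth (gpow d (e + of_nat r * d)) (m - r))"
    unfolding gH by (intro sum.cong refl) (simp add: fps_X_power_mult_nth mult_ac)
  finally show ?thesis unfolding H_def .
qed

section \<open>Linear independence and residues\<close>

text \<open>
  The operator \<open>g\<^bsup>-d\<^esup> d/dx\<close> has the eigenvector \<open>g\<^bsup>a\<^esup>\<close> for the eigenvalue \<open>a\<close>, and eigenvectors
  for distinct eigenvalues are independent.
\<close>

lemma gpow_independent:
  assumes "finite S" "(\<Sum>a\<in>S. fps_const (F a) * gpow d (of_int a)) = 0" "a \<in> S"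
  shows "F a = (0::complex)"
  using assms
proof (induction S arbitrary: F a rule: finite_induct)
  case empty
  then show ?case by simp
next
  case (insert b S)
  have rel: "fps_const (F b) * gpow d (of_int b) + (\<Sum>a\<in>S. fps_const (F a) * gpow d (of_int a)) = 0"
    using insert.prems insert.hyps by simp
  have "fps_deriv (fps_const (F b) * gpow d (of_int b) + (\<Sum>a\<in>S. fps_const (F a) * gpow d (of_int a)))
      = gpow d d * (fps_const (of_int b * F b) * gpow d (of_int b)
          + (\<Sum>a\<in>S. fps_const (of_int a * F a) * gpow d (of_int a)))"
    by (simp add: fps_deriv_sum gpow_deriv distrib_left sum_distrib_left gpow_add add.commute
        mult.commute mult.left_commute flip: fps_const_mult gpow_add)
  then have "gpow d d * (fps_const (of_int b * F b) * gpow d (of_int b)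
          + (\<Sum>a\<in>S. fps_const (of_int a * F a) * gpow d (of_int a))) = 0"
    using rel by simp
  then have rel': "fps_const (of_int b * F b) * gpow d (of_int b)
          + (\<Sum>a\<in>S. fps_const (of_int a * F a) * gpow d (of_int a)) = 0"
    by simp
  \<comment> \<open>subtracting \<open>b\<close> times the relation removes the term of \<open>b\<close>\<close>
  have "(\<Sum>a\<in>S. fps_const ((of_int a - of_int b) * F a) * gpow d (of_int a))
      = (\<Sum>a\<in>S. fps_const (of_int a * F a) * gpow d (of_int a))
        - fps_const (of_int b) * (\<Sum>a\<in>S. fps_const (F a) * gpow d (of_int a))"
    unfolding sum_distrib_left sum_subtractf[symmetric]
    by (intro sum.cong refl) (simp add: algebra_simps flip: fps_const_mult fps_const_sub)
  also have "\<dots> = 0"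
    using rel rel' by (simp add: add_eq_0_iff mult.assoc flip: fps_const_mult)
  finally have "(of_int a' - of_int b) * F a' = 0" if "a' \<in> S" for a'
    using insert.IH[of "\<lambda>a. (of_int a - of_int b) * F a"] that by blast
  then have S0: "F a' = 0" if "a' \<in> S" for a'
    using that insert.hyps by fastforce
  then have "fps_const (F b) * gpow d (of_int b) = 0" using rel by simp
  then have "F b = 0"
    using arg_cong[of _ 0 "\<lambda>f. fps_nth f 0"] by (fastforce)
  with S0 insert.prems show ?case by blast
qed

lemma fls_deriv_fps_to_fls_gpow:
  "fls_deriv (fps_to_fls (gpow d a)) = fps_to_fls (fps_const a * gpow d (a + d))"
  by (simp only: fls_deriv_fps_to_fls gpow_deriv)

text \<open>
  The series \<open>p\<close> with \<open>g - 1 = x p\<close>.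
\<close>

definition gpow_quot :: "complex \<Rightarrow> complex fps" where
  "gpow_quot d = fps_shift 1 (gpow d 1)"

lemma gpow_quot_eq: "gpow d 1 - 1 = fps_X * gpow_quot d"
  by (rule fps_ext) (simp add: gpow_quot_def)

lemma gpow_quot_nth_0 [simp]: "fps_nth (gpow_quot d) 0 = 1"
  using gpow_nth_Suc[of 0 d 1] by (simp add: gpow_quot_def)

lemma gpow_quot_inverse: "gpow_quot d * inverse (gpow_quot d) = 1"
  by (rule inverse_mult_eq_1') simp

text \<open>
  The series \<open>g - 1\<close>, in the field of Laurent series because it is going to be inverted.
\<close>

definition gincr :: "complex \<Rightarrow> complex fls" where
  "gincr d = fps_to_fls (gpow d 1 - 1)"

lemma gincr_inverse: "gincr d * (fps_to_fls (inverse (gpow_quot d)) * fls_X_inv) = 1"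
proof -
  have "gincr d * (fps_to_fls (inverse (gpow_quot d)) * fls_X_inv)
     = (fls_X * fls_X_inv) * fps_to_fls (gpow_quot d * inverse (gpow_quot d))"
    by (simp only: gincr_def gpow_quot_eq fls_times_fps_to_fls fps_X_to_fls mult_ac)
  also have "fls_X * (fls_X_inv :: complex fls) = 1"
    by (simp add: fls_X_times_conv_shift fls_X_inv_conv_shift_1)
  finally show ?thesis by (simp only: gpow_quot_inverse) simp
qed

lemma gincr_nonzero: "gincr d \<noteq> 0"
  using gincr_inverse[of d] by auto

lemma inverse_gincr: "inverse (gincr d) = fps_to_fls (inverse (gpow_quot d)) * fls_X_inv"
  using gincr_inverse[of d] by (metis inverse_unique)

lemma fls_deriv_gincr: "fls_deriv (gincr d) = fps_to_fls (gpow d (1 + d))"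
  by (simp add: gincr_def fls_deriv_fps_to_fls gpow_deriv)

lemma fls_residue_sum: "fls_residue (\<Sum>a\<in>S. f a) = (\<Sum>a\<in>S. fls_residue (f a))"
  by (simp add: fls_nth_sum)

lemma fls_residue_const_diff:
  "fls_residue (fls_const a * F - fls_const b * G) = a * fls_residue F - b * fls_residue (G :: complex fls)"
  by simp

text \<open>
  With \<open>y = g - 1\<close> the claim is the residue of \<open>y\<^bsup>-k-1\<^esup> (1 + y)\<^bsup>a\<^esup> dy\<close>. Instead of changing
  variables, one uses that the derivative of \<open>y\<^bsup>-k-1\<^esup> g\<^bsup>a\<^esup>\<close> has no residue: this gives the
  recursion of the binomial coefficients in \<open>k\<close>.
\<close>

lemma residue_gpow:
  "fls_residue (fls_deriv (gincr d) * inverse (gincr d) ^ Suc k * fps_to_fls (gpow d a)) = a gchoose k"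
proof (induction k arbitrary: a)
  case 0
  have "fls_deriv (gincr d) * inverse (gincr d) ^ Suc 0 * fps_to_fls (gpow d a)
     = fls_X_inv * fps_to_fls (gpow d (1 + d) * inverse (gpow_quot d) * gpow d a)"
    by (simp add: fls_deriv_gincr inverse_gincr fls_times_fps_to_fls mult_ac)
  then show ?case by (simp add: fls_X_inv_times_conv_shift)
next
  case (Suc k)
  define y where "y = gincr d"
  define G where "G = (\<lambda>a. fps_to_fls (gpow d a))"
  have y0: "y \<noteq> 0" by (simp add: y_def gincr_nonzero)
  have G': "fls_deriv (G a) = fls_const a * (fls_deriv y * G (a - 1))"
  proof -
    have *: "gpow d (a + d) = gpow d (1 + d) * gpow d (a - 1)" by (simp add: gpow_add add.commute)
    have "fls_deriv (G a) = fls_const a * (fps_to_fls (gpow d (1 + d)) * fps_to_fls (gpow d (a - 1)))"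
      unfolding G_def fls_deriv_fps_to_fls_gpow fls_times_fps_to_fls fps_const_to_fls
      by (simp only: * fls_times_fps_to_fls)
    then show ?thesis by (simp only: G_def y_def fls_deriv_gincr)
  qed
  have pw: "fls_deriv (inverse y ^ Suc k) = - (of_nat (Suc k) * (fls_deriv y * inverse y ^ Suc (Suc k)))"
    by (simp only: fls_deriv_power fls_inverse_deriv) (simp add: power2_eq_square mult_ac)
  have "fls_deriv (inverse y ^ Suc k * G a)
     = fls_const a * (fls_deriv y * inverse y ^ Suc k * G (a - 1))
       - fls_const (of_nat (Suc k)) * (fls_deriv y * inverse y ^ Suc (Suc k) * G a)"
  proof -
    have "r * (x * (p * h)) + - (n * (p * q)) * g = x * (p * r * h) - n * (p * q * g)"
      for r x p h n q g :: "complex fls" by algebra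
    then show ?thesis unfolding fls_deriv_mult pw G' fls_of_nat by blast
  qed
  from arg_cong[OF this, of fls_residue]
  have "0 = a * fls_residue (fls_deriv y * inverse y ^ Suc k * G (a - 1))
       - of_nat (Suc k) * fls_residue (fls_deriv y * inverse y ^ Suc (Suc k) * G a)"
    unfolding fls_residue_deriv fls_residue_const_diff .
  then have "of_nat (Suc k) * fls_residue (fls_deriv y * inverse y ^ Suc (Suc k) * G a)
     = a * ((a - 1) gchoose k)"
    using Suc.IH[of "a - 1"] unfolding y_def G_def by (simp only: right_minus_eq eq_commute[of 0])
  also have "\<dots> = of_nat (Suc k) * (a gchoose Suc k)"
    by (rule gbinomial_absorption[symmetric])
  finally show ?case unfolding y_def G_def by (simp only: mult_cancel_left of_nat_eq_0_iff) simp
qed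

lemma residue_of_expansion:
  assumes "gincr d ^ k * A = (\<Sum>a\<in>S. fls_const (F a) * fps_to_fls (gpow d (of_int a)))"
  shows "fls_residue (fls_deriv (gincr d) * inverse (gincr d) * A) = (\<Sum>a\<in>S. F a * (of_int a gchoose k))"
proof -
  define y where "y = gincr d"
  have "y \<noteq> 0" by (simp add: y_def gincr_nonzero)
  then have "fls_deriv y * inverse y * A = fls_deriv y * inverse y ^ Suc k * (y ^ k * A)"
    by (simp add: field_simps)
  also have "\<dots> = (\<Sum>a\<in>S. fls_const (F a) *
       (fls_deriv y * inverse y ^ Suc k * fps_to_fls (gpow d (of_int a))))"
    unfolding y_def assms sum_distrib_left by (intro sum.cong refl) (simp only: mult_ac)
  finally have "fls_residue (fls_deriv y * inverse y * A) = (\<Sum>a\<in>S. fls_residue (fls_const (F a) *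
       (fls_deriv y * inverse y ^ Suc k * fps_to_fls (gpow d (of_int a)))))"
    by (simp only: fls_residue_sum)
  then show ?thesis
    by (simp only: y_def fls_residue_fls_const_times residue_gpow)
qed

lemma fps_times_fls_nth:
  fixes A :: "complex fls"
  shows "fls_nth (fps_to_fls f * A) j = Sum_any (\<lambda>i::nat. fps_nth f i * fls_nth A (j - int i))"
proof -
  define df where "df = fls_subdegree (fps_to_fls f)"
  define dA where "dA = fls_subdegree A"
  have df: "0 \<le> df" unfolding df_def by (simp add: fls_subdegree_fls_to_fps)
  have "fls_nth (fps_to_fls f * A) j = (\<Sum>i=df..j - dA. fls_nth (fps_to_fls f) i * fls_nth A (j - i))"
    unfolding df_def dA_def by (rule fls_times_nth)
  also have "\<dots> = (\<Sum>i=0..j - dA. fls_nth (fps_to_fls f) i * fls_nth A (j - i))"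
    using df by (intro sum.mono_neutral_left) (auto simp: df_def simp del: fps_to_fls_nth)
  also have "\<dots> = (\<Sum>i\<in>{i. int i \<le> j - dA}. fps_nth f i * fls_nth A (j - int i))"
    by (rule sum.reindex_bij_witness[of _ int nat]) auto
  also have "\<dots> = Sum_any (\<lambda>i::nat. fps_nth f i * fls_nth A (j - int i))"
  proof (rule Sum_any.expand_superset[symmetric])
    show "finite {i. int i \<le> j - dA}"
      by (rule finite_subset[of _ "{..nat (j - dA)}"]) auto
    show "{i. fps_nth f i * fls_nth A (j - int i) \<noteq> 0} \<subseteq> {i. int i \<le> j - dA}"
      using fls_subdegree_leI unfolding dA_def by force
  qed
  finally show ?thesis .
qed

lemma residue_dlog_gincr:
  "fls_residue (fls_deriv (gincr d) * inverse (gincr d) * A)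
     = Sum_any (\<lambda>i::nat. fps_nth (gpow d (1 + d) * inverse (gpow_quot d)) i * fls_nth A (- int i))"
proof -
  have "fls_deriv (gincr d) * inverse (gincr d) * A
      = fls_X_inv * (fps_to_fls (gpow d (1 + d) * inverse (gpow_quot d)) * A)"
    unfolding fls_deriv_gincr inverse_gincr fls_times_fps_to_fls by (simp only: mult_ac)
  then have "fls_residue (fls_deriv (gincr d) * inverse (gincr d) * A)
      = fls_nth (fps_to_fls (gpow d (1 + d) * inverse (gpow_quot d)) * A) 0"
    by (simp add: fls_X_inv_times_conv_shift)
  also have "\<dots> = Sum_any (\<lambda>i::nat. fps_nth (gpow d (1 + d) * inverse (gpow_quot d)) i * fls_nth A (0 - int i))"
    by (rule fps_times_fls_nth)
  finally show ?thesis by simp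
qed

section \<open>Substitution into Laurent series\<close>

text \<open>
  The Laurent version of \<open>gpow_mult_compose_nth\<close>, in the shape in which the skew-symmetry of a vertex
  algebra produces the coefficients: the index \<open>i\<close> counts down from \<open>j\<close> in the exponents of \<open>B\<close>.
\<close>

lemma gpow_mult_fls_compose_nth:
  "fls_nth (fps_to_fls (gpow d e) * fls_compose_fps B (- (fps_X * gpow d d))) j
     = (-1) powi j * Sum_any (\<lambda>i::nat. (-1) ^ i * fls_nth B (j - int i)
         * fps_nth (gpow d (e + of_int (j - int i) * d)) i)"
proof -
  define H where "H = - (fps_X * gpow d d)"
  have H: "H \<noteq> 0" "fps_nth H 0 = 0" by (simp_all add: H_def)
  define N where "N = nat (- fls_subdegree B)"
  define B' where "B' = Abs_fps (\<lambda>i. fls_nth B (int i - int N))"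
  have low: "fls_nth B r = 0" if "r < - int N" for r
    using that unfolding N_def by (intro fls_eq0_below_subdegree) linarith
  have B: "B = fls_shift (int N) (fps_to_fls B')"
    by (rule fls_eqI) (simp add: B'_def low)
  have "fps_to_fls H * (- (fls_X_inv * fps_to_fls (gpow d (- d))))
      = (fls_X * fls_X_inv) * fps_to_fls (gpow d d * gpow d (- d))"
    by (simp only: H_def fps_to_fls_uminus fls_times_fps_to_fls fps_X_to_fls minus_mult_minus mult_ac)
  also have "fls_X * (fls_X_inv :: complex fls) = 1"
    by (simp add: fls_X_times_conv_shift fls_X_inv_conv_shift_1)
  finally have "inverse (fps_to_fls H) = - (fls_X_inv * fps_to_fls (gpow d (- d)))"
    by (intro inverse_unique) (simp add: gpow_add)
  then have "fps_to_fls H powi (- int N) = (- (fls_X_inv * fps_to_fls (gpow d (- d)))) ^ N"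
    by (simp add: power_int_minus flip: power_inverse)
  also have "\<dots> = (-1) ^ N * (fls_X_inv ^ N * fps_to_fls (gpow d (- (of_nat N * d))))"
    by (simp only: power_minus[of "fls_X_inv * fps_to_fls (gpow d (- d))"] power_mult_distrib
        fps_to_fls_power[symmetric] gpow_power mult_minus_right)
  finally have Hpow: "fps_to_fls H powi (- int N)
      = fls_const ((-1) ^ N) * (fls_X_inv ^ N * fps_to_fls (gpow d (- (of_nat N * d))))"
    by (simp add: fls_const_power)
  define Q where "Q = gpow d (e + - (of_nat N * d)) * (B' oo H)"
  have "fps_to_fls (gpow d e) * fls_compose_fps B H
      = fls_const ((-1) ^ N) * (fls_X_inv ^ N * fps_to_fls Q)"
    unfolding B fls_compose_fps_shift[OF H(1)] fls_compose_fps_to_fls[OF H] Hpow Q_def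
      gpow_add[symmetric] fls_times_fps_to_fls by (simp only: mult_ac)
  then have lhs: "fls_nth (fps_to_fls (gpow d e) * fls_compose_fps B H) j
      = (-1) ^ N * fls_nth (fps_to_fls Q) (j + int N)"
    by (simp add: fls_X_inv_power_times_conv_shift)
  show ?thesis
  proof (cases "j + int N < 0")
    case True
    then have "fls_nth B (j - int i) = 0" for i by (intro low) simp
    with True lhs show ?thesis by (simp add: H_def)
  next
    case False
    define m where "m = nat (j + int N)"
    have j: "j = int m - int N" using False by (simp add: m_def)
    have "Sum_any (\<lambda>i::nat. (-1) ^ i * fls_nth B (j - int i) * fps_nth (gpow d (e + of_int (j - int i) * d)) i)
        = (\<Sum>i=0..m. (-1) ^ i * fls_nth B (j - int i) * fps_nth (gpow d (e + of_int (j - int i) * d)) i)"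
      by (rule Sum_any.expand_superset) (auto simp: j low not_le intro: ccontr)
    also have "\<dots> = (\<Sum>r=0..m. (-1) ^ m * ((-1) ^ r * fps_nth B' r
        * fps_nth (gpow d (e + - (of_nat N * d) + of_nat r * d)) (m - r)))"
    proof (rule sum.reindex_bij_witness[of _ "\<lambda>r. m - r" "\<lambda>r. m - r"])
      fix i assume i: "i \<in> {0..m}"
      have "(-1 :: complex) ^ m * (-1) ^ (m - i) = (-1) ^ (m + (m - i))" by (simp add: power_add)
      also have "\<dots> = (-1) ^ i" using i by (simp add: minus_one_power_iff)
      finally have sgn: "(-1 :: complex) ^ m * (-1) ^ (m - i) = (-1) ^ i" .
      \<comment> \<open>\<open>- N d\<close> comes from \<open>H\<^bsup>-N\<^esup>\<close>, and it is absorbed by \<open>j = m - N\<close>\<close>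
      have e1: "e + - (of_nat N * d) + of_nat (m - i) * d = e + of_int (j - int i) * d"
        using i by (simp add: j of_nat_diff algebra_simps)
      have e2: "fps_nth B' (m - i) = fls_nth B (j - int i)"
        using i by (simp add: B'_def j of_nat_diff algebra_simps)
      have e3: "m - (m - i) = i" using i by simp
      show "(-1) ^ m * ((-1) ^ (m - i) * fps_nth B' (m - i)
          * fps_nth (gpow d (e + - (of_nat N * d) + of_nat (m - i) * d)) (m - (m - i)))
        = (-1) ^ i * fls_nth B (j - int i) * fps_nth (gpow d (e + of_int (j - int i) * d)) i"
        unfolding e1 e2 e3 sgn[symmetric] by (simp only: mult_ac)
    qed auto
    also have "\<dots> = (-1) ^ m * fps_nth Q m"
      unfolding Q_def H_def gpow_mult_compose_nth by (simp only: sum_distrib_left)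
    finally have "(-1) powi j * Sum_any (\<lambda>i::nat. (-1) ^ i * fls_nth B (j - int i)
         * fps_nth (gpow d (e + of_int (j - int i) * d)) i) = ((-1) powi j * (-1) ^ m) * fps_nth Q m"
      by simp
    also have "(-1 :: complex) powi j * (-1) ^ m = (-1) ^ N"
    proof -
      have "(-1 :: complex) powi j = (-1) ^ m * (-1) ^ N"
        by (simp add: j power_int_diff minus_one_power_iff)
      then show ?thesis by (simp add: minus_one_power_iff)
    qed
    finally show ?thesis using lhs False by (simp add: H_def m_def)
  qed
qed

section \<open>Multiplication by the difference of two variables on one total degree\<close>

lemma Sum_any_reindex_inj:
  assumes "inj h" "\<And>x. x \<notin> range h \<Longrightarrow> f x = 0"
  shows "Sum_any f = Sum_any (\<lambda>y. f (h y))"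
proof -
  have eq: "{x. f x \<noteq> 0} = h ` {y. f (h y) \<noteq> 0}"
  proof (intro equalityI subsetI)
    fix x assume x: "x \<in> {x. f x \<noteq> 0}"
    then obtain y where "x = h y" using assms(2)[of x] by (cases "x \<in> range h") auto
    with x show "x \<in> h ` {y. f (h y) \<noteq> 0}" by simp
  qed auto
  have inj: "inj_on h {y. f (h y) \<noteq> 0}" using assms(1) by (rule inj_on_subset) (rule subset_UNIV)
  have "Sum_any f = sum f (h ` {y. f (h y) \<noteq> 0})" by (simp only: Sum_any.expand_set eq)
  also have "\<dots> = sum (\<lambda>y. f (h y)) {y. f (h y) \<noteq> 0}" by (rule sum.reindex_cong[OF inj refl refl])
  also have "\<dots> = Sum_any (\<lambda>y. f (h y))" by (rule Sum_any.expand_set[symmetric])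
  finally show ?thesis .
qed

text \<open>
  If \<open>F a\<close> is the coefficient of \<open>z\<^sub>1\<^bsup>a\<^esup> z\<^sub>2\<^bsup>c-a\<^esup>\<close>, this is the coefficient of
  \<open>z\<^sub>1\<^bsup>a\<^esup> z\<^sub>2\<^bsup>c+1-a\<^esup>\<close> in the product with \<open>z\<^sub>1 - z\<^sub>2\<close>.
\<close>

definition dif :: "(int \<Rightarrow> complex) \<Rightarrow> int \<Rightarrow> complex" where
  "dif F a = F (a - 1) - F a"

lemma dif_pow_Suc: "(dif ^^ Suc k) F a = (dif ^^ k) F (a - 1) - (dif ^^ k) F a"
  by (simp only: funpow.simps o_apply dif_def[of "(dif ^^ k) F"])

lemma finite_support_shift:
  fixes F :: "int \<Rightarrow> complex"
  assumes "finite {a. F a \<noteq> 0}"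
  shows "finite {a. F (a - 1) \<noteq> 0}"
proof -
  have "{a. F (a - 1) \<noteq> 0} = (\<lambda>a. a + 1) ` {a. F a \<noteq> 0}"
    by (auto simp: image_iff) (metis diff_add_cancel)
  then show ?thesis using assms by simp
qed

lemma finite_support_dif:
  assumes "finite {a. F a \<noteq> 0}"
  shows "finite {a. dif F a \<noteq> 0}"
  by (rule finite_subset[OF _ finite_UnI[OF assms finite_support_shift[OF assms]]])
     (auto simp: dif_def)

lemma finite_support_dif_pow:
  assumes "finite {a. F a \<noteq> 0}"
  shows "finite {a. (dif ^^ k) F a \<noteq> 0}"
  using assms by (induction k) (auto intro: finite_support_dif)

lemma dif_pow_cong:
  assumes "\<And>b. a - int k \<le> b \<Longrightarrow> b \<le> a \<Longrightarrow> F b = G b"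
  shows "(dif ^^ k) F a = (dif ^^ k) G a"
  using assms
proof (induction k arbitrary: a)
  case (Suc k)
  then have "(dif ^^ k) F a = (dif ^^ k) G a" "(dif ^^ k) F (a - 1) = (dif ^^ k) G (a - 1)"
    by simp_all
  then show ?case by (simp only: dif_pow_Suc)
qed simp

text \<open>
  Reflection exchanges the two variables, and \<open>(z\<^sub>2 - z\<^sub>1)\<^bsup>k\<^esup> = (-1)\<^bsup>k\<^esup> (z\<^sub>1 - z\<^sub>2)\<^bsup>k\<^esup>\<close>.
\<close>

lemma dif_pow_reflect:
  "(dif ^^ k) (\<lambda>p. Z (c - p)) a = (-1) ^ k * (dif ^^ k) Z (c + int k - a)"
proof (induction k arbitrary: a)
  case (Suc k)
  have "c + int (Suc k) - a - 1 = c + int k - a" "c + int k - (a - 1) = c + int (Suc k) - a"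
    by simp_all
  with Suc.IH show ?case by (simp add: dif_pow_Suc algebra_simps del: funpow.simps)
qed simp

lemma Sum_any_shift: "Sum_any (\<lambda>a::int. f (a - 1)) = Sum_any f"
  by (rule Sum_any.reindex_cong[of "\<lambda>a. a + 1"])
     (auto simp: fun_eq_iff bij_iff intro!: exI[of _ "_ - 1"])

text \<open>
  Summation by parts: the difference of \<open>a choose k+1\<close> is \<open>a choose k\<close>.
\<close>

lemma Sum_any_binomial_dif:
  assumes "finite {a. F a \<noteq> 0}"
  shows "Sum_any (\<lambda>a. dif F a * (of_int a gchoose Suc k)) = Sum_any (\<lambda>a. F a * (of_int a gchoose k))"
proof -
  have pascal: "F a * (of_int a + 1 gchoose Suc k) - F a * (of_int a gchoose Suc k)
      = F a * (of_int a gchoose k)" for a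
    by (simp only: gbinomial_Suc_Suc) (simp add: algebra_simps)
  define f where "f = (\<lambda>a. F a * (of_int (a + 1) gchoose Suc k))"
  have fin: "finite {a. f a \<noteq> 0}" "finite {a. - (F a * (of_int a gchoose Suc k)) \<noteq> 0}"
    by (rule finite_subset[OF _ assms], auto simp: f_def)+
  have "Sum_any (\<lambda>a. dif F a * (of_int a gchoose Suc k))
      = Sum_any (\<lambda>a. f (a - 1) + - (F a * (of_int a gchoose Suc k)))"
    by (simp add: dif_def f_def algebra_simps)
  also have "\<dots> = Sum_any (\<lambda>a. f (a - 1)) + Sum_any (\<lambda>a. - (F a * (of_int a gchoose Suc k)))"
    by (rule Sum_any.distrib[OF finite_support_shift[OF fin(1)] fin(2)])
  also have "\<dots> = Sum_any (\<lambda>a. f a + - (F a * (of_int a gchoose Suc k)))"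
    unfolding Sum_any_shift by (rule Sum_any.distrib[OF fin, symmetric])
  also have "\<dots> = Sum_any (\<lambda>a. F a * (of_int a gchoose k))"
    by (simp add: f_def pascal)
  finally show ?thesis .
qed

lemma Sum_any_binomial_dif_pow:
  assumes "finite {a. F a \<noteq> 0}"
  shows "Sum_any (\<lambda>a. (dif ^^ k) F a * (of_int a gchoose k)) = Sum_any F"
proof (induction k)
  case (Suc k)
  have "Sum_any (\<lambda>a. (dif ^^ Suc k) F a * (of_int a gchoose Suc k))
      = Sum_any (\<lambda>a. dif ((dif ^^ k) F) a * (of_int a gchoose Suc k))" by simp
  also have "\<dots> = Sum_any F"
    unfolding Sum_any_binomial_dif[OF finite_support_dif_pow[OF assms]] by (rule Suc.IH)
  finally show ?case .
qed simp

text \<open>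
  Neither \<open>X\<close> nor \<open>Z\<close> is summable by itself. The spliced sequence \<open>T\<close> has finite support, so summation
  by parts applies to it. Its \<open>k\<close>th difference agrees with that of \<open>X\<close> outside \<open>{0..<k}\<close>, where the
  window of the difference operator straddles the splice, and there the binomial coefficient vanishes.
\<close>

lemma Sum_any_splice:
  assumes X: "\<And>p. p \<ge> N \<Longrightarrow> X p = 0" and Z: "\<And>p. p \<le> M \<Longrightarrow> Z p = 0"
    and eq: "(dif ^^ k) X = (dif ^^ k) Z"
  shows "Sum_any (\<lambda>a. (dif ^^ k) X a * (of_int a gchoose k)) = Sum_any (\<lambda>p. if p \<ge> 0 then X p else Z p)"
proof -
  define T where "T = (\<lambda>p. if p \<ge> 0 then X p else Z p)"
  have fT: "finite {a. T a \<noteq> 0}"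
  proof (rule finite_subset)
    show "{a. T a \<noteq> 0} \<subseteq> {min M 0..max N 0}"
    proof
      fix a assume "a \<in> {a. T a \<noteq> 0}"
      then have "X a \<noteq> 0 \<and> a \<ge> 0 \<or> Z a \<noteq> 0 \<and> a < 0" by (auto simp: T_def split: if_splits)
      then show "a \<in> {min M 0..max N 0}"
        using X[of a] Z[of a] by fastforce
    qed
  qed simp
  have ptw: "(dif ^^ k) X a * (of_int a gchoose k) = (dif ^^ k) T a * (of_int a gchoose k)" for a
  proof -
    consider "a < 0" | "0 \<le> a" "a < int k" | "a \<ge> int k" by linarith
    then show ?thesis
    proof cases
      case 1
      then have "(dif ^^ k) T a = (dif ^^ k) Z a" by (intro dif_pow_cong) (simp add: T_def)
      then show ?thesis by (simp add: eq)
    next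
      case 2
      then obtain n where "a = int n" "n < k" by (metis nonneg_int_cases of_nat_less_iff)
      then have "(of_int a :: complex) gchoose k = 0"
        by (simp flip: binomial_gbinomial)
      then show ?thesis by simp
    next
      case 3
      then have "(dif ^^ k) T a = (dif ^^ k) X a" by (intro dif_pow_cong) (simp add: T_def)
      then show ?thesis by simp
    qed
  qed
  show ?thesis unfolding ptw Sum_any_binomial_dif_pow[OF fT] by (simp only: T_def)
qed

section \<open>Expansions in powers of the coordinate series\<close>

text \<open>
  The generating series of a finitely supported \<open>F\<close>, with the monomials replaced by powers of \<open>g\<close>.
\<close>

definition gsum :: "complex \<Rightarrow> (int \<Rightarrow> complex) \<Rightarrow> complex fls" where
  "gsum d F = Sum_any (\<lambda>a. fls_const (F a) * fps_to_fls (gpow d (of_int a)))"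

lemma gsum_superset:
  assumes "finite S" "{a. F a \<noteq> 0} \<subseteq> S"
  shows "gsum d F = (\<Sum>a\<in>S. fls_const (F a) * fps_to_fls (gpow d (of_int a)))"
  unfolding gsum_def using assms by (intro Sum_any.expand_superset) auto

lemma gincr_times_gsum:
  assumes "finite {a. F a \<noteq> 0}"
  shows "gincr d * gsum d F = gsum d (dif F)"
proof -
  define f where "f = (\<lambda>a. fls_const (F a) * fps_to_fls (gpow d (of_int a)))"
  define f' where "f' = (\<lambda>a. fls_const (F a) * fps_to_fls (gpow d (of_int (a + 1))))"
  have fin: "finite {a. f a \<noteq> 0}" "finite {a. f' a \<noteq> 0}" "finite {a. - f a \<noteq> 0}"
    by (rule finite_subset[OF _ assms], auto simp: f_def f'_def)+
  have fin': "finite {a. f' (a - 1) \<noteq> 0}"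
    by (rule finite_subset[OF _ finite_support_shift[OF assms]]) (auto simp: f'_def)
  have "gincr d * f a = f' a + - f a" for a
    by (simp add: f_def f'_def gincr_def algebra_simps flip: fls_times_fps_to_fls gpow_add)
  then have "gincr d * gsum d F = Sum_any (\<lambda>a. f' a + - f a)"
    unfolding gsum_def using Sum_any_right_distrib[OF fin(1), of "gincr d"] by (simp add: f_def)
  also have "\<dots> = Sum_any (\<lambda>a. f' (a - 1)) + Sum_any (\<lambda>a. - f a)"
    unfolding Sum_any_shift by (rule Sum_any.distrib[OF fin(2,3)])
  also have "\<dots> = Sum_any (\<lambda>a. f' (a - 1) + - f a)"
    by (rule Sum_any.distrib[OF fin' fin(3), symmetric])
  also have "\<dots> = gsum d (dif F)"
    by (simp add: gsum_def f_def f'_def dif_def left_diff_distrib flip: fls_minus_const)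
  finally show ?thesis .
qed

lemma gincr_pow_times_gsum:
  assumes "finite {a. F a \<noteq> 0}"
  shows "gincr d ^ k * gsum d F = gsum d ((dif ^^ k) F)"
proof (induction k)
  case (Suc k)
  then show ?case
    using gincr_times_gsum[OF finite_support_dif_pow[OF assms, of k], of d] by (simp add: mult.assoc)
qed simp

lemma gsum_inject:
  assumes "finite {a. F a \<noteq> 0}" "finite {a. G a \<noteq> 0}" "gsum d F = gsum d G"
  shows "F = G"
proof
  fix b
  define S where "S = insert b ({a. F a \<noteq> 0} \<union> {a. G a \<noteq> 0})"
  have S: "finite S" "{a. F a \<noteq> 0} \<subseteq> S" "{a. G a \<noteq> 0} \<subseteq> S" "b \<in> S" using assms by (auto simp: S_def)
  have conv: "(\<Sum>a\<in>S. fls_const (H a) * fps_to_fls (gpow d (of_int a)))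
     = fps_to_fls (\<Sum>a\<in>S. fps_const (H a) * gpow d (of_int a))" for H
    using \<open>finite S\<close> by (induction S rule: finite_induct) (simp_all add: fls_times_fps_to_fls)
  have "(\<Sum>a\<in>S. fps_const (F a) * gpow d (of_int a)) = (\<Sum>a\<in>S. fps_const (G a) * gpow d (of_int a))"
    using assms(3) unfolding gsum_superset[OF S(1,2)] gsum_superset[OF S(1,3)] conv by simp
  then have "(\<Sum>a\<in>S. fps_const (F a - G a) * gpow d (of_int a)) = 0"
    by (simp add: sum_subtractf left_diff_distrib flip: fps_const_sub)
  from gpow_independent[OF S(1) this S(4)] show "F b = G b" by simp
qed

lemma gsum_compose:
  assumes "finite {a. F a \<noteq> 0}"
  shows "fls_compose_fps (gsum d F) (- (fps_X * gpow d d)) = gsum d (\<lambda>a. F (- a))"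
proof -
  define H where "H = - (fps_X * gpow d d)"
  have H: "H \<noteq> 0" "fps_nth H 0 = 0" by (simp_all add: H_def)
  define S where "S = {a. F a \<noteq> 0}"
  have "fls_compose_fps (\<Sum>a\<in>S. f a) H = (\<Sum>a\<in>S. fls_compose_fps (f a) H)" for f
    using assms unfolding S_def[symmetric]
    by (induction S rule: finite_induct) (simp_all add: fls_compose_fps_add[OF H])
  then have "fls_compose_fps (gsum d F) H
     = (\<Sum>a\<in>S. fls_compose_fps (fls_const (F a) * fps_to_fls (gpow d (of_int a))) H)"
    by (simp add: gsum_def Sum_any.expand_superset[OF assms] S_def subset_eq)
  also have "\<dots> = (\<Sum>a\<in>S. fls_const (F a) * fps_to_fls (gpow d (of_int (- a))))"
    by (simp add: fls_compose_fps_mult[OF H] fls_compose_fps_to_fls[OF H])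
       (simp add: H_def gpow_compose)
  also have "\<dots> = (\<Sum>a\<in>uminus ` S. fls_const (F (- a)) * fps_to_fls (gpow d (of_int a)))"
    by (subst sum.reindex) (auto simp: inj_on_def)
  also have "\<dots> = gsum d (\<lambda>a. F (- a))"
  proof (rule gsum_superset[symmetric])
    show "{a. F (- a) \<noteq> 0} \<subseteq> uminus ` S"
      by (auto simp: S_def intro: image_eqI[where x = "- x" for x])
  qed (use assms in \<open>simp add: S_def\<close>)
  finally show ?thesis by (simp add: H_def)
qed

lemma gpow_times_gsum:
  assumes "finite {a. F a \<noteq> 0}"
  shows "fps_to_fls (gpow d (of_int b)) * gsum d F = gsum d (\<lambda>a. F (a - b))"
proof -
  have "fps_to_fls (gpow d (of_int b)) * gsum d F
      = Sum_any (\<lambda>a. fps_to_fls (gpow d (of_int b)) * (fls_const (F a) * fps_to_fls (gpow d (of_int a))))"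
    unfolding gsum_def
    by (rule Sum_any_right_distrib, rule finite_subset[OF _ assms]) auto
  also have "\<dots> = Sum_any (\<lambda>a. fls_const (F a) * fps_to_fls (gpow d (of_int (a + b))))"
    by (simp add: mult.left_commute add.commute gpow_add flip: fls_times_fps_to_fls)
  also have "\<dots> = gsum d (\<lambda>a. F (a - b))"
  proof -
    have "gsum d (\<lambda>a. F (a - b)) = Sum_any (\<lambda>a. (\<lambda>a. fls_const (F (a - b)) * fps_to_fls (gpow d (of_int a))) (a + b))"
      unfolding gsum_def
    proof (rule Sum_any_reindex_inj)
      fix x :: int assume "x \<notin> range (\<lambda>a. a + b)"
      moreover have "x = (x - b) + b" by simp
      ultimately show "fls_const (F (x - b)) * fps_to_fls (gpow d (of_int x)) = 0" by blast
    qed (simp add: inj_on_def)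
    then show ?thesis by simp
  qed
  finally show ?thesis .
qed

section \<open>The reciprocal series as a sum over partitions\<close>

definition partitions_upto :: "nat \<Rightarrow> nat \<Rightarrow> (nat \<Rightarrow> nat) set" where
  "partitions_upto M n = {r \<in> {1..M} \<rightarrow>\<^sub>E (UNIV :: nat set). (\<Sum>m=1..M. m * r m) = n}"

definition partition_weight :: "(nat \<Rightarrow> complex) \<Rightarrow> nat \<Rightarrow> (nat \<Rightarrow> nat) \<Rightarrow> complex" where
  "partition_weight q M r = (-1) ^ (\<Sum>m=1..M. r m) * fact (\<Sum>m=1..M. r m) *
        (\<Prod>m=1..M. 1 / fact (r m) * q m ^ r m)"

lemma finite_partitions_upto: "finite (partitions_upto M n)"
proof (rule finite_subset)
  show "partitions_upto M n \<subseteq> {1..M} \<rightarrow>\<^sub>E {..n}"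
  proof
    fix r assume r: "r \<in> partitions_upto M n"
    have "r m \<le> n" if m: "m \<in> {1..M}" for m
    proof -
      have "r m \<le> m * r m" using m by simp
      also have "\<dots> \<le> (\<Sum>m=1..M. m * r m)" using m by (intro member_le_sum) auto
      also have "\<dots> = n" using r by (simp add: partitions_upto_def)
      finally show ?thesis .
    qed
    with r show "r \<in> {1..M} \<rightarrow>\<^sub>E {..n}" by (auto simp: partitions_upto_def PiE_def Pi_def)
  qed
  show "finite ({1..M} \<rightarrow>\<^sub>E {..n})" by (intro finite_PiE) auto
qed

lemma partition_weight_step:
  assumes m: "m \<in> {1..M}" and s: "s = r(m := Suc (r m))"
  shows "partition_weight q M s * of_nat (s m) = - q m * of_nat (\<Sum>m=1..M. s m) * partition_weight q M r"
proof -
  have S: "(\<Sum>j=1..M. s j) = Suc (\<Sum>j=1..M. r j)"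
  proof -
    have "(\<Sum>j=1..M. s j) = s m + (\<Sum>j\<in>{1..M} - {m}. s j)" by (rule sum.remove) (use m in auto)
    also have "(\<Sum>j\<in>{1..M} - {m}. s j) = (\<Sum>j\<in>{1..M} - {m}. r j)" by (rule sum.cong) (auto simp: s)
    also have "s m + \<dots> = Suc (r m + (\<Sum>j\<in>{1..M} - {m}. r j))" by (simp add: s)
    also have "r m + (\<Sum>j\<in>{1..M} - {m}. r j) = (\<Sum>j=1..M. r j)" by (rule sum.remove[symmetric]) (use m in auto)
    finally show ?thesis .
  qed
  define P where "P = (\<Prod>j\<in>{1..M} - {m}. 1 / fact (r j) * q j ^ r j)"
  have "(\<Prod>j=1..M. 1 / fact (s j) * q j ^ s j)
      = (1 / fact (s m) * q m ^ s m) * (\<Prod>j\<in>{1..M} - {m}. 1 / fact (s j) * q j ^ s j)"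
    by (rule prod.remove) (use m in auto)
  also have "(\<Prod>j\<in>{1..M} - {m}. 1 / fact (s j) * q j ^ s j) = P"
    unfolding P_def by (rule prod.cong) (auto simp: s)
  finally have ps: "(\<Prod>j=1..M. 1 / fact (s j) * q j ^ s j) = (1 / fact (s m) * q m ^ s m) * P" .
  have pr: "(\<Prod>j=1..M. 1 / fact (r j) * q j ^ r j) = (1 / fact (r m) * q m ^ r m) * P"
    unfolding P_def by (rule prod.remove) (use m in auto)
  define A B where "A = 1 / fact (s m) * q m ^ s m" and "B = 1 / fact (r m) * q m ^ r m"
  have AB: "A * of_nat (s m) = q m * B"
    by (simp add: A_def B_def s del: of_nat_Suc)
  define R where "R = (\<Sum>j=1..M. r j)"
  have "(-1) ^ Suc R * fact (Suc R) * (A * P) * of_nat (s m)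
      = (-1) ^ Suc R * fact (Suc R) * P * (A * of_nat (s m))" by (simp only: mult_ac)
  also have "\<dots> = - q m * of_nat (Suc R) * ((-1) ^ R * fact R * (B * P))"
    unfolding AB by (simp add: mult_ac del: of_nat_Suc)
  finally show ?thesis unfolding partition_weight_def S ps pr A_def B_def R_def .
qed

text \<open>
  The weight of \<open>r\<close> is split according to \<open>r m / \<Sum>j. r j\<close>. The share of \<open>m\<close> is \<open>- q m\<close> times the weight of \<open>r\<close>
  with one part \<open>m\<close> removed (\<open>partition_weight_step\<close>), which is a partition of \<open>n - m\<close>. The bound \<open>M\<close> on the parts is kept fixed so that all
  these partitions live in the same function space.
\<close>

lemma partition_sum_recursion:
  assumes "0 < n" "n \<le> M"
  shows "(\<Sum>r\<in>partitions_upto M n. partition_weight q M r)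
    = - (\<Sum>m=1..n. q m * (\<Sum>r\<in>partitions_upto M (n - m). partition_weight q M r))"
proof -
  let ?w = "partition_weight q M"
  define N where "N = (\<lambda>r :: nat \<Rightarrow> nat. of_nat (\<Sum>m=1..M. r m) :: complex)"
  have N0: "N r \<noteq> 0" if "r \<in> partitions_upto M n" for r
  proof
    assume "N r = 0"
    then have "\<forall>m\<in>{1..M}. r m = 0" by (simp add: N_def flip: of_nat_sum)
    then have "(\<Sum>m=1..M. m * r m) = 0" by simp
    with that assms(1) show False by (simp add: partitions_upto_def)
  qed
  have "(\<Sum>r\<in>partitions_upto M n. ?w r)
      = (\<Sum>r\<in>partitions_upto M n. \<Sum>m=1..M. ?w r * of_nat (r m) / N r)"
    by (intro sum.cong refl)
       (use N0 in \<open>simp add: sum_distrib_left[symmetric] sum_divide_distrib[symmetric] N_def\<close>)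
  also have "\<dots> = (\<Sum>m=1..M. \<Sum>r\<in>partitions_upto M n. ?w r * of_nat (r m) / N r)"
    by (rule sum.swap)
  also have "\<dots> = (\<Sum>m=1..M. if m \<le> n then - q m * (\<Sum>r\<in>partitions_upto M (n - m). ?w r) else 0)"
  proof (intro sum.cong refl)
    fix m assume m: "m \<in> {1..M}"
    have deg: "(\<Sum>j=1..M. j * r j) = m * r m + (\<Sum>j\<in>{1..M} - {m}. j * r j)" for r :: "nat \<Rightarrow> nat"
      by (rule sum.remove) (use m in auto)
    show "(\<Sum>r\<in>partitions_upto M n. ?w r * of_nat (r m) / N r)
       = (if m \<le> n then - q m * (\<Sum>r\<in>partitions_upto M (n - m). ?w r) else 0)"
    proof (cases "m \<le> n")
      case False
      have "r m = 0" if "r \<in> partitions_upto M n" for r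
      proof (rule ccontr)
        assume "r m \<noteq> 0"
        then have "m \<le> m * r m" by simp
        also have "\<dots> \<le> n" using that deg[of r] by (simp add: partitions_upto_def)
        finally show False using False by simp
      qed
      then have "(\<Sum>r\<in>partitions_upto M n. ?w r * of_nat (r m) / N r) = 0"
        by (intro sum.neutral) simp
      then show ?thesis using False by simp
    next
      case True
      have "(\<Sum>r\<in>partitions_upto M n. ?w r * of_nat (r m) / N r)
          = (\<Sum>r\<in>{r \<in> partitions_upto M n. r m \<noteq> 0}. ?w r * of_nat (r m) / N r)"
        using finite_partitions_upto by (intro sum.mono_neutral_right) auto
      also have "\<dots> = (\<Sum>r\<in>partitions_upto M (n - m). - q m * ?w r)"
      proof (rule sum.reindex_bij_witness
            [where i = "\<lambda>r. r(m := Suc (r m))" and j = "\<lambda>r. r(m := r m - 1)"])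
        fix r
        assume r: "r \<in> {r \<in> partitions_upto M n. r m \<noteq> 0}"
        show "(r(m := r m - 1))(m := Suc ((r(m := r m - 1)) m)) = r" using r by auto
        have "(\<Sum>j\<in>{1..M} - {m}. j * (r(m := r m - 1)) j) = (\<Sum>j\<in>{1..M} - {m}. j * r j)"
          by (rule sum.cong) auto
        then have "(\<Sum>j=1..M. j * (r(m := r m - 1)) j) = n - m"
          using r deg[of r] unfolding deg[of "r(m := r m - 1)"]
          by (auto simp: partitions_upto_def diff_mult_distrib2)
        then show "r(m := r m - 1) \<in> partitions_upto M (n - m)"
          using r m by (auto simp: partitions_upto_def PiE_def extensional_def)
        have "?w r * of_nat (r m) = - q m * N r * ?w (r(m := r m - 1))"
          unfolding N_def using r by (intro partition_weight_step[OF m]) auto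
        then show "- q m * ?w (r(m := r m - 1)) = ?w r * of_nat (r m) / N r"
          using N0 r by (simp add: field_simps)
      next
        fix r
        assume r: "r \<in> partitions_upto M (n - m)"
        show "(r(m := Suc (r m)))(m := (r(m := Suc (r m))) m - 1) = r" by simp
        have "(\<Sum>j\<in>{1..M} - {m}. j * (r(m := Suc (r m))) j) = (\<Sum>j\<in>{1..M} - {m}. j * r j)"
          by (rule sum.cong) auto
        then have "(\<Sum>j=1..M. j * (r(m := Suc (r m))) j) = n"
          using r deg[of r] True unfolding deg[of "r(m := Suc (r m))"]
          by (auto simp: partitions_upto_def)
        then show "r(m := Suc (r m)) \<in> {r \<in> partitions_upto M n. r m \<noteq> 0}"
          using r m by (auto simp: partitions_upto_def PiE_def extensional_def)
      qed
      finally show ?thesis using True by (simp add: sum_distrib_left)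
    qed
  qed
  also have "\<dots> = (\<Sum>m=1..n. - q m * (\<Sum>r\<in>partitions_upto M (n - m). ?w r))"
    using assms by (intro sum.mono_neutral_cong_right) auto
  finally show ?thesis by (simp add: sum_negf)
qed

text \<open>
  The sums satisfy the recursion that defines the coefficients of \<open>1/f\<close>.
\<close>

lemma partition_sum_inverse:
  assumes q0: "fps_nth f 0 = 1" and n: "n \<le> M"
  shows "(\<Sum>r\<in>partitions_upto M n. partition_weight (fps_nth f) M r) = fps_nth (inverse f) n"
  using n
proof (induction n rule: less_induct)
  case (less n)
  show ?case
  proof (cases "n = 0")
    case True
    have "partitions_upto M 0 = {\<lambda>m\<in>{1..M}. 0}"
      by (auto simp: partitions_upto_def PiE_def extensional_def fun_eq_iff)
    then show ?thesis using True q0 by (simp add: partition_weight_def)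
  next
    case False
    then have n_pos: "0 < n" by simp
    have "(\<Sum>r\<in>partitions_upto M n. partition_weight (fps_nth f) M r)
       = - (\<Sum>m=1..n. fps_nth f m * fps_nth (inverse f) (n - m))"
      unfolding partition_sum_recursion[OF n_pos less.prems]
      using less by (intro arg_cong[of _ _ uminus] sum.cong refl) (simp add: algebra_simps)
    moreover have "fps_nth (f * inverse f) n = 0"
      using inverse_mult_eq_1'[of f] q0 False by simp
    then have "fps_nth (inverse f) n + (\<Sum>m=1..n. fps_nth f m * fps_nth (inverse f) (n - m)) = 0"
      unfolding fps_mult_nth by (simp add: sum.atLeast_Suc_atMost q0)
    ultimately show ?thesis by (simp only: eq_neg_iff_add_eq_0[symmetric])
  qed
qed

lemma gpow_quot_nth: "fps_nth (gpow_quot (of_int (\<epsilon> - 1))) m = eps_prod \<epsilon> m / fact (m + 1)"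
proof -
  have "(\<Prod>s<Suc m. 1 + of_nat s * of_int (\<epsilon> - 1) :: complex) = eps_prod \<epsilon> m"
    unfolding prod.lessThan_Suc_shift eps_prod_def by (simp add: algebra_simps)
  then show ?thesis by (simp add: gpow_quot_def gpow_def)
qed

lemma gpow_eps_nth: "fps_nth (gpow (of_int (\<epsilon> - 1)) (of_int \<epsilon>)) m = eps_prod \<epsilon> m / fact m"
  by (simp add: gpow_def eps_prod_def)

lemma h_coeff_eq: "h_coeff \<epsilon> n = fps_nth (inverse (gpow_quot (of_int (\<epsilon> - 1)))) n"
proof (cases "n = 0")
  case False
  have "fps_nth (gpow_quot (of_int (\<epsilon> - 1))) = (\<lambda>m. eps_prod \<epsilon> m / fact (m + 1))"
    using gpow_quot_nth by blast
  with False partition_sum_inverse[of "gpow_quot (of_int (\<epsilon> - 1))" n n] show ?thesis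
    by (simp add: h_coeff_def partitions_upto_def partition_weight_def)
qed (simp add: h_coeff_def)

text \<open>
  The left-hand series is \<open>g' / p\<close>, that is, \<open>x\<close> times the logarithmic derivative of \<open>g - 1\<close>, and
  \<open>1 + (\<epsilon> - 1) = \<epsilon>\<close> makes \<open>g'\<close> the exponential generating series of \<open>eps_prod \<epsilon>\<close>.
\<close>

lemma dlog_coefficient:
  "fps_nth (gpow (of_int (\<epsilon> - 1)) (1 + of_int (\<epsilon> - 1)) * inverse (gpow_quot (of_int (\<epsilon> - 1)))) n
     = (\<Sum>i=0..n. 1 / fact i * eps_prod \<epsilon> i * h_coeff \<epsilon> (n - i))"
proof -
  have "1 + of_int (\<epsilon> - 1) = (of_int \<epsilon> :: complex)" by simp
  then show ?thesis unfolding fps_mult_nth h_coeff_eq by (simp only: gpow_eps_nth) simp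
qed

section \<open>Linear functionals\<close>

lemma linear_Sum_any:
  assumes "Vector_Spaces.linear s1 s2 L" "finite {a. f a \<noteq> 0}"
  shows "L (Sum_any f) = Sum_any (\<lambda>a. L (f a))"
proof -
  interpret L: Vector_Spaces.linear s1 s2 L by fact
  have "Sum_any (\<lambda>a. L (f a)) = (\<Sum>a\<in>{a. f a \<noteq> 0}. L (f a))"
    by (rule Sum_any.expand_superset) (use assms in \<open>auto simp: L.zero\<close>)
  then show ?thesis by (simp add: Sum_any.expand_set L.sum)
qed

lemma Sum_any_nat_split:
  fixes f :: "nat \<Rightarrow> 'a::comm_monoid_add"
  assumes "finite {n. f n \<noteq> 0}"
  shows "Sum_any f = f 0 + Sum_any (\<lambda>n. f (Suc n))"
proof -
  have fin: "finite {n. f (Suc n) \<noteq> 0}"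
    using finite_vimageI[OF assms, of Suc] by (simp add: vimage_def)
  have "Sum_any f = (\<Sum>n\<in>insert 0 (Suc ` {n. f (Suc n) \<noteq> 0}). f n)"
  proof (rule Sum_any.expand_superset)
    show "{n. f n \<noteq> 0} \<subseteq> insert 0 (Suc ` {n. f (Suc n) \<noteq> 0})"
    proof
      fix n assume "n \<in> {n. f n \<noteq> 0}"
      then show "n \<in> insert 0 (Suc ` {n. f (Suc n) \<noteq> 0})" by (cases n) auto
    qed
  qed (use fin in simp)
  also have "\<dots> = f 0 + Sum_any (\<lambda>n. f (Suc n))"
    using fin by (simp add: sum.reindex Sum_any.expand_set)
  finally show ?thesis .
qed

text \<open>
  A nonzero vector extends to a basis. Through this fact the whole proof takes place in \<open>\<complex>\<close>.
\<close>

lemma eq_if_functionals_eq: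
  fixes scale :: "complex \<Rightarrow> 'w::ab_group_add \<Rightarrow> 'w"
  assumes "vector_space scale"
    and functionals: "\<And>L. Vector_Spaces.linear scale ((*) :: complex \<Rightarrow> _) L \<Longrightarrow> L x = L y"
  shows "x = y"
proof (rule ccontr)
  assume "x \<noteq> y"
  interpret W: vector_space scale by fact
  have indep: "W.independent {x - y}" using \<open>x \<noteq> y\<close> by simp
  interpret C: vector_space "(*) :: complex \<Rightarrow> complex \<Rightarrow> complex"
    by standard (auto simp: algebra_simps)
  interpret P: vector_space_pair scale "(*) :: complex \<Rightarrow> complex \<Rightarrow> complex" ..
  obtain L where L: "Vector_Spaces.linear scale (*) L" "L (x - y) = 1"
    using P.linear_independent_extend[OF indep, of "\<lambda>_. 1"] by auto
  interpret L: Vector_Spaces.linear scale "(*)" L by (fact L(1))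
  from functionals[OF L(1)] L(2) show False by (simp add: L.diff)
qed

section \<open>Skew-symmetry of the vertex algebra\<close>

context vertex_algebra
begin

text \<open>
  This is \<open>Y(v,z) u = e\<^bsup>z T\<^esup> Y(u,-z) v\<close> with \<open>a\<^sub>-\<^sub>i\<^sub>-\<^sub>1 vac = T\<^bsup>i\<^esup> a / i!\<close>, and it is the Jacobi identity on the
  vacuum for \<open>m = -1\<close> and \<open>n = 0\<close>: creation kills the first sum and leaves one term of the second.
\<close>

lemma skew_symmetry:
  "scale (- ((-1) powi l)) (Y v l u)
     = Sum_any (\<lambda>i::nat. scale ((-1) ^ i) (Y (Y u (l + int i) v) (- 1 - int i) vac))"
proof -
  have Y0: "Y a n 0 = 0" for a n
  proof -
    interpret l: Vector_Spaces.linear scale scale "Y a n" by (rule linear_mode)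
    show ?thesis by (rule l.zero)
  qed
  have "Sum_any (\<lambda>i::nat. scale ((-1) ^ i * (of_int l gchoose i) * (-1) powi l)
           (Y v (0 + l - int i) (Y u (-1 + int i) vac)))
      = Sum_any (\<lambda>i::nat. if i = 0 then scale ((-1) powi l) (Y v l u) else 0)"
    by (intro Sum_any.cong) (simp add: creation Y0)
  then show ?thesis
    using jacobi[of l u "-1" v 0 vac] by (simp add: creation Y0 gbinomial_minus binomial_gbinomial[symmetric])
qed

lemma skew_symmetry_finite:
  "finite {i::nat. Y (Y u (l + int i) v) (- 1 - int i) vac \<noteq> 0}"
proof -
  obtain N where N: "\<And>n. n \<ge> N \<Longrightarrow> Y u n v = 0" using truncation by blast
  have "Y 0 n w = 0" for n w
  proof -
    interpret l: Vector_Spaces.linear scale scale "\<lambda>u. Y u n w" by (rule linear_state)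
    show ?thesis by (rule l.zero)
  qed
  note Y0 = this
  have "{i::nat. Y (Y u (l + int i) v) (- 1 - int i) vac \<noteq> 0} \<subseteq> {..nat (N - l)}"
  proof
    fix i assume "i \<in> {i::nat. Y (Y u (l + int i) v) (- 1 - int i) vac \<noteq> 0}"
    then have "\<not> N \<le> l + int i" using N[of "l + int i"] Y0 by auto
    then show "i \<in> {..nat (N - l)}" by simp
  qed
  then show ?thesis by (rule finite_subset) simp
qed

end

section \<open>Homogeneous series in two variables\<close>

text \<open>
  The series \<open>z\<^sub>2\<^bsup>b\<^esup> f(z\<^sub>0 z\<^sub>2\<^bsup>d\<^esup>)\<close>.
\<close>

definition homog :: "int \<Rightarrow> int \<Rightarrow> complex fps \<Rightarrow> complex fls fps" where
  "homog d b f = Abs_fps (\<lambda>n. fls_const (fps_nth f n) * fls_X_intpow (b + int n * d))"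

lemma homog_nth: "fls_nth (fps_nth (homog d b f) n) m = (if m = b + int n * d then fps_nth f n else 0)"
  by (simp add: homog_def)

lemma homog_mult: "homog d b f * homog d c g = homog d (b + c) (f * g)"
proof (rule fps_ext, rule fls_eqI)
  fix n m
  have "fps_nth (homog d b f) i * fps_nth (homog d c g) (n - i)
      = fls_const (fps_nth f i * fps_nth g (n - i)) * fls_X_intpow (b + c + int n * d)"
    if "i \<le> n" for i
  proof -
    have "fps_nth (homog d b f) i * fps_nth (homog d c g) (n - i)
        = fls_const (fps_nth f i * fps_nth g (n - i))
          * (fls_X_intpow (b + int i * d) * fls_X_intpow (c + int (n - i) * d))"
      by (simp only: homog_def fps_nth_Abs_fps mult_ac flip: fls_const_mult_const)
    also have "fls_X_intpow (b + int i * d) * fls_X_intpow (c + int (n - i) * d)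
        = (fls_X_intpow (b + c + int n * d) :: complex fls)"
      using that by (simp only: fls_X_intpow_times_fls_X_intpow) (simp add: of_nat_diff algebra_simps)
    finally show ?thesis .
  qed
  then have "fps_nth (homog d b f * homog d c g) n
     = (\<Sum>i=0..n. fls_const (fps_nth f i * fps_nth g (n - i)) * fls_X_intpow (b + c + int n * d))"
    unfolding fps_mult_nth by (intro sum.cong) auto
  then show "fls_nth (fps_nth (homog d b f * homog d c g) n) m
      = fls_nth (fps_nth (homog d (b + c) (f * g)) n) m"
    by (simp add: homog_nth fls_nth_sum fps_mult_nth)
qed

lemma homog_1: "homog d 0 1 = 1"
  by (rule fps_ext, rule fls_eqI) (simp add: homog_nth)

lemma homog_power: "homog d b f ^ k = homog d (int k * b) (f ^ k)"
  by (induction k) (simp_all add: homog_1 homog_mult algebra_simps)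

lemma phi_eq_homog: "phi \<epsilon> = homog (\<epsilon> - 1) 1 (gpow (of_int (\<epsilon> - 1)) 1)"
proof -
  let ?d = "\<epsilon> - 1"
  have "((\<lambda>f. fls_X_intpow \<epsilon> * fls_deriv f) ^^ n) (fls_X :: complex fls)
      = fls_const (\<Prod>s<n. 1 + of_nat s * of_int ?d) * fls_X_intpow (1 + int n * ?d)" for n
  proof (induction n)
    case 0
    show ?case by (rule fls_eqI) simp
  next
    case (Suc n)
    define P :: complex where "P = (\<Prod>s<n. 1 + of_nat s * of_int ?d)"
    define e where "e = 1 + int n * ?d"
    have e: "(of_int e :: complex) = 1 + of_nat n * of_int ?d" by (simp add: e_def)
    have "fls_X_intpow \<epsilon> * fls_deriv (fls_const P * fls_X_intpow e)
        = fls_const P * (fls_const (of_int e) * (fls_X_intpow \<epsilon> * fls_X_intpow (e - 1)))"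
      by (simp only: fls_deriv_mult_const_left fls_deriv_X_intpow fls_of_int mult.left_commute)
    also have "\<dots> = fls_const (P * of_int e) * fls_X_intpow (\<epsilon> + (e - 1))"
      by (simp only: fls_X_intpow_times_fls_X_intpow fls_const_mult_const flip: mult.assoc)
    also have "\<epsilon> + (e - 1) = 1 + int (Suc n) * ?d" by (simp add: e_def algebra_simps)
    finally show ?case unfolding funpow.simps o_apply Suc.IH P_def e_def[symmetric] e by simp
  qed
  then show ?thesis unfolding phi_def
    by (simp only: homog_def gpow_def fps_nth_Abs_fps fls_const_mult_const flip: mult.assoc) simp
qed

lemma phi_powi: "phi \<epsilon> powi a = homog (\<epsilon> - 1) a (gpow (of_int (\<epsilon> - 1)) (of_int a))"
proof -
  let ?d = "of_int (\<epsilon> - 1) :: complex"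
  have "phi \<epsilon> * homog (\<epsilon> - 1) (- 1) (gpow ?d (- 1)) = 1"
    by (simp add: phi_eq_homog homog_mult gpow_add homog_1)
  then have "inverse (phi \<epsilon>) = homog (\<epsilon> - 1) (- 1) (gpow ?d (- 1))"
    by (rule fps_inverse_unique)
  then show ?thesis
    by (simp add: power_int_def homog_power gpow_power phi_eq_homog)
qed

lemma phi_minus_z2_power:
  "(phi \<epsilon> - fps_const fls_X) ^ k = homog (\<epsilon> - 1) (int k) ((gpow (of_int (\<epsilon> - 1)) 1 - 1) ^ k)"
proof -
  have "phi \<epsilon> - fps_const fls_X = homog (\<epsilon> - 1) 1 (gpow (of_int (\<epsilon> - 1)) 1 - 1)"
    unfolding phi_eq_homog by (rule fps_ext, rule fls_eqI) (simp add: homog_nth)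
  then show ?thesis by (simp add: homog_power)
qed

lemma coeff02_homog:
  "coeff02 (homog d b f) j m = (if 0 \<le> j \<and> m = b + j * d then fps_nth f (nat j) else 0)"
  by (simp add: coeff02_def homog_nth)

text \<open>
  The coefficient of \<open>z\<^sub>0\<^bsup>j\<^esup> z\<^sub>2\<^bsup>c + j d\<^esup>\<close> in \<open>F(\<phi>\<^sub>\<epsilon>(z\<^sub>2,z\<^sub>0), z\<^sub>2)\<close> only involves the part of \<open>F\<close> of total
  degree \<open>c\<close>, since \<open>\<phi>\<^sub>\<epsilon>\<^bsup>a\<^esup> z\<^sub>2\<^bsup>c-a\<^esup> = z\<^sub>2\<^bsup>c\<^esup> g(x)\<^bsup>a\<^esup>\<close>.
\<close>

lemma functional_subst_phi:
  assumes L: "Vector_Spaces.linear scale ((*) :: complex \<Rightarrow> _) L"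
    and F: "laurent2 F"
  shows "L (subst_phi scale \<epsilon> F j (c + j * (\<epsilon> - 1)))
     = fls_nth (gsum (of_int (\<epsilon> - 1)) (\<lambda>a. L (F a (c - a)))) j"
    and "finite {a. L (F a (c - a)) \<noteq> 0}"
proof -
  interpret L: Vector_Spaces.linear scale "(*)" L by fact
  let ?d = "of_int (\<epsilon> - 1) :: complex"
  obtain N where N: "\<And>a b. a < N \<or> b < N \<Longrightarrow> F a b = 0" using F by (auto simp: laurent2_def)
  have sub: "{a. F a (c - a) \<noteq> 0} \<subseteq> {N..c - N}" using N by force
  then have fin: "finite {a. F a (c - a) \<noteq> 0}" by (rule finite_subset) simp
  have fin': "finite {a. L (F a (c - a)) \<noteq> 0}"
    by (rule finite_subset[OF _ fin]) (auto simp: L.zero)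
  then show "finite {a. L (F a (c - a)) \<noteq> 0}" .
  have G: "fls_nth (gsum ?d (\<lambda>a. L (F a (c - a)))) j
      = (\<Sum>a\<in>{N..c-N}. L (F a (c - a)) * fls_nth (fps_to_fls (gpow ?d (of_int a))) j)"
    using sub by (subst gsum_superset[of "{N..c-N}"]) (auto simp: L.zero fls_nth_sum)
  show "L (subst_phi scale \<epsilon> F j (c + j * (\<epsilon> - 1)))
     = fls_nth (gsum (of_int (\<epsilon> - 1)) (\<lambda>a. L (F a (c - a)))) j"
  proof (cases "j < 0")
    case True
    then show ?thesis unfolding G by (simp add: subst_phi_def coeff02_def split_def L.vs1.scale_zero_left L.zero)
  next
    case False
    define f where "f = (\<lambda>p. scale (coeff02 (phi \<epsilon> powi fst p) j (c + j * (\<epsilon> - 1) - snd p)) (F (fst p) (snd p)))"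
    have fa: "f (a, c - a) = scale (fps_nth (gpow ?d (of_int a)) (nat j)) (F a (c - a))" for a
      using False by (simp add: f_def phi_powi coeff02_homog)
    have "subst_phi scale \<epsilon> F j (c + j * (\<epsilon> - 1)) = Sum_any f"
      by (simp add: subst_phi_def f_def split_def)
    also have "\<dots> = Sum_any (\<lambda>a. f (a, c - a))"
    proof (rule Sum_any_reindex_inj)
      fix p :: "int \<times> int" assume "p \<notin> range (\<lambda>a. (a, c - a))"
      have "snd p \<noteq> c - fst p"
      proof
        assume "snd p = c - fst p"
        then have "p = (fst p, c - fst p)" by (simp add: prod_eq_iff)
        with \<open>p \<notin> _\<close> show False by blast
      qed
      then have "c + j * (\<epsilon> - 1) - snd p \<noteq> fst p + j * (\<epsilon> - 1)" by simp
      then show "f p = 0" by (simp add: f_def phi_powi coeff02_homog L.vs1.scale_zero_left)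
    qed (auto simp: inj_on_def)
    also have "\<dots> = (\<Sum>a\<in>{N..c-N}. f (a, c - a))"
      by (rule Sum_any.expand_superset) (use sub in \<open>auto simp: fa L.vs1.scale_zero_right\<close>)
    finally show ?thesis using False unfolding G by (simp add: L.sum fa L.scale mult.commute)
  qed
qed

text \<open>
  Likewise, a homogeneous factor acts on the coefficients of \<open>S\<close> along the line \<open>m = c + j d\<close> as
  multiplication of Laurent series in \<open>x\<close>.
\<close>

lemma functional_times02:
  assumes L: "Vector_Spaces.linear scale ((*) :: complex \<Rightarrow> _) L"
    and T: "\<And>j. j < N \<Longrightarrow> T j = 0"
    and S: "\<And>j. S j (c + j * d) = T j"
  shows "L (times02 scale (homog d b f) S j (c + b + j * d))
     = fls_nth (fps_to_fls f * Abs_fls (\<lambda>j. L (T j))) j"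
proof -
  interpret L: Vector_Spaces.linear scale "(*)" L by fact
  have nth: "fls_nth (Abs_fls (\<lambda>j. L (T j))) = (\<lambda>j. L (T j))"
    by (rule ext, rule nth_Abs_fls_lower_bound[of N]) (simp add: T L.zero)
  define g where "g = (\<lambda>p. scale (coeff02 (homog d b f) (fst p) (snd p)) (S (j - fst p) (c + b + j * d - snd p)))"
  have gi: "g (int i, b + int i * d) = scale (fps_nth f i) (T (j - int i))" for i
    using S[of "j - int i"] by (simp add: g_def coeff02_homog algebra_simps)
  have "times02 scale (homog d b f) S j (c + b + j * d) = Sum_any g"
    by (simp add: times02_def g_def split_def)
  also have "\<dots> = Sum_any (\<lambda>i::nat. g (int i, b + int i * d))"
  proof (rule Sum_any_reindex_inj)
    fix p :: "int \<times> int" assume p: "p \<notin> range (\<lambda>i. (int i, b + int i * d))"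
    have "\<not> (0 \<le> fst p \<and> snd p = b + fst p * d)"
    proof
      assume "0 \<le> fst p \<and> snd p = b + fst p * d"
      then have "p = (int (nat (fst p)), b + int (nat (fst p)) * d)" by (simp add: prod_eq_iff)
      with p show False by blast
    qed
    then show "g p = 0" by (auto simp: g_def coeff02_homog L.vs1.scale_zero_left)
  qed (auto simp: inj_on_def)
  also have "\<dots> = Sum_any (\<lambda>i::nat. scale (fps_nth f i) (T (j - int i)))" by (simp only: gi)
  finally have sum: "times02 scale (homog d b f) S j (c + b + j * d)
      = Sum_any (\<lambda>i::nat. scale (fps_nth f i) (T (j - int i)))" .
  have "{i::nat. scale (fps_nth f i) (T (j - int i)) \<noteq> 0} \<subseteq> {..nat (j - N)}"
  proof
    fix i assume "i \<in> {i::nat. scale (fps_nth f i) (T (j - int i)) \<noteq> 0}"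
    then have "\<not> j - int i < N" using T[of "j - int i"] by (auto simp: L.vs1.scale_zero_right)
    then show "i \<in> {..nat (j - N)}" by simp
  qed
  then have "finite {i::nat. scale (fps_nth f i) (T (j - int i)) \<noteq> 0}"
    by (rule finite_subset) simp
  from linear_Sum_any[OF L this]
  have "L (times02 scale (homog d b f) S j (c + b + j * d))
      = Sum_any (\<lambda>i::nat. L (scale (fps_nth f i) (T (j - int i))))"
    unfolding sum .
  then show ?thesis by (simp add: fps_times_fls_nth nth L.scale)
qed

lemma slice_times_z1_minus_z2:
  assumes L: "Vector_Spaces.linear scale ((*) :: complex \<Rightarrow> _) L"
  shows "L ((times_z1_minus_z2 ^^ k) F a (c + int k - a)) = (dif ^^ k) (\<lambda>p. L (F p (c - p))) a"
proof (induction k arbitrary: a)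
  case (Suc k)
  interpret L: Vector_Spaces.linear scale "(*)" L by fact
  have e: "c + int (Suc k) - a = c + int k - (a - 1)" "c + int k - (a - 1) - 1 = c + int k - a" by simp_all
  have "L ((times_z1_minus_z2 ^^ Suc k) F a (c + int (Suc k) - a))
      = L ((times_z1_minus_z2 ^^ k) F (a - 1) (c + int k - (a - 1)))
        - L ((times_z1_minus_z2 ^^ k) F a (c + int k - a))"
    by (simp only: funpow.simps o_apply times_z1_minus_z2_def[of "(times_z1_minus_z2 ^^ k) F"] L.diff e)
  then show ?case by (simp only: Suc.IH dif_pow_Suc)
qed simp

section \<open>Matrix coefficients of the module\<close>

context phi_coordinated_module
begin

text \<open>
  The part of \<open>L(Y\<^sub>W(Y(u,z\<^sub>0)v, z\<^sub>2) w)\<close> of the form \<open>z\<^sub>2\<^bsup>c\<^esup>\<close> times a Laurent series in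
  \<open>x = z\<^sub>0 z\<^sub>2\<^bsup>\<epsilon>-1\<^esup>\<close>.
\<close>

definition iterate_series :: "('w \<Rightarrow> complex) \<Rightarrow> 'v \<Rightarrow> 'v \<Rightarrow> int \<Rightarrow> 'w \<Rightarrow> complex fls" where
  "iterate_series L u v c w = Abs_fls (\<lambda>j. L (YW (Y u (- j - 1) v) (- (c + j * (\<epsilon> - 1)) - 1) w))"

definition product_coeff :: "('w \<Rightarrow> complex) \<Rightarrow> 'v \<Rightarrow> 'v \<Rightarrow> int \<Rightarrow> 'w \<Rightarrow> int \<Rightarrow> complex" where
  "product_coeff L u v c w p = L (prod12 (YW u) (YW v) w p (c - p))"

lemma YW_0_state [simp]: "YW 0 n w = 0"
proof -
  interpret l: Vector_Spaces.linear scaleV scaleW "\<lambda>v. YW v n w" by (rule linear_state)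
  show ?thesis by (rule l.zero)
qed

lemma YW_0 [simp]: "YW v n 0 = 0"
proof -
  interpret l: Vector_Spaces.linear scaleW scaleW "YW v n" by (rule linear_mode)
  show ?thesis by (rule l.zero)
qed

context
  fixes L :: "'w \<Rightarrow> complex"
  assumes L: "Vector_Spaces.linear scaleW (*) L"
begin

interpretation L: Vector_Spaces.linear scaleW "(*)" L
  by (rule L)

lemma iterate_truncation: "\<exists>N. \<forall>j<N. YW (Y u (- j - 1) v) (- (c + j * (\<epsilon> - 1)) - 1) w = 0"
proof -
  obtain N where N: "\<And>n. n \<ge> N \<Longrightarrow> Y u n v = 0" using V.truncation by blast
  show ?thesis by (rule exI[of _ "- N"]) (simp add: N)
qed

lemma iterate_series_nth:
  "fls_nth (iterate_series L u v c w) j = L (YW (Y u (- j - 1) v) (- (c + j * (\<epsilon> - 1)) - 1) w)"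
proof -
  obtain N where N: "\<And>j. j < N \<Longrightarrow> YW (Y u (- j - 1) v) (- (c + j * (\<epsilon> - 1)) - 1) w = 0"
    using iterate_truncation by blast
  show ?thesis unfolding iterate_series_def
    by (rule nth_Abs_fls_lower_bound[of N]) (intro allI impI, simp only: N L.zero)
qed

text \<open>
  An exponent that works for weak associativity can be increased. This is used in \<open>locality\<close> to have
  the same exponent for \<open>(u, v)\<close> and \<open>(v, u)\<close>.
\<close>

lemma weak_assoc_series:
  "\<exists>K. \<forall>k\<ge>K. finite {a. (dif ^^ k) (product_coeff L u v c w) a \<noteq> 0} \<and>
     gincr (of_int (\<epsilon> - 1)) ^ k * iterate_series L u v c w
       = gsum (of_int (\<epsilon> - 1)) ((dif ^^ k) (product_coeff L u v c w))"
proof -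
  let ?d = "of_int (\<epsilon> - 1) :: complex" and ?X = "product_coeff L u v c w"
  obtain k where lau: "laurent2 ((times_z1_minus_z2 ^^ k) (prod12 (YW u) (YW v) w))"
    and assoc: "times02 scaleW ((phi \<epsilon> - fps_const fls_X) ^ k)
              (\<lambda>j m. YW (Y u (- j - 1) v) (- m - 1) w)
            = subst_phi scaleW \<epsilon> ((times_z1_minus_z2 ^^ k) (prod12 (YW u) (YW v) w))"
    using weak_assoc[of u v] by blast
  define F where "F = (times_z1_minus_z2 ^^ k) (prod12 (YW u) (YW v) w)"
  have slice: "(\<lambda>a. L (F a (c + int k - a))) = (dif ^^ k) ?X"
    unfolding F_def slice_times_z1_minus_z2[OF L] product_coeff_def ..
  note sub1 = functional_subst_phi(1)[OF L lau[folded F_def], where c = "c + int k" and \<epsilon> = \<epsilon>, unfolded slice]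
  have sub2: "finite {a. (dif ^^ k) ?X a \<noteq> 0}"
    unfolding slice[symmetric] by (rule functional_subst_phi(2)[OF L lau[folded F_def]])
  obtain N where N: "\<And>j. j < N \<Longrightarrow> YW (Y u (- j - 1) v) (- (c + j * (\<epsilon> - 1)) - 1) w = 0"
    using iterate_truncation by blast
  have base: "gincr ?d ^ k * iterate_series L u v c w = gsum ?d ((dif ^^ k) ?X)"
  proof (rule fls_eqI)
    fix j
    have "fls_nth (gincr ?d ^ k * iterate_series L u v c w) j
        = L (times02 scaleW (homog (\<epsilon> - 1) (int k) ((gpow ?d 1 - 1) ^ k))
              (\<lambda>j m. YW (Y u (- j - 1) v) (- m - 1) w) j (c + int k + j * (\<epsilon> - 1)))"
      unfolding gincr_def iterate_series_def fps_to_fls_power[symmetric]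
      by (rule functional_times02[OF L, where N = N and
            T = "\<lambda>j. YW (Y u (- j - 1) v) (- (c + j * (\<epsilon> - 1)) - 1) w", symmetric])
         (simp_all only: N)
    also have "\<dots> = L (subst_phi scaleW \<epsilon> F j (c + int k + j * (\<epsilon> - 1)))"
      unfolding phi_minus_z2_power[symmetric] assoc F_def ..
    also have "\<dots> = fls_nth (gsum ?d ((dif ^^ k) ?X)) j" by (rule sub1)
    finally show "fls_nth (gincr ?d ^ k * iterate_series L u v c w) j = fls_nth (gsum ?d ((dif ^^ k) ?X)) j" .
  qed
  show ?thesis
  proof (intro exI[of _ k] allI impI)
    fix l assume "k \<le> l"
    then obtain m where l: "l = m + k" by (metis add.commute le_Suc_ex)
    have "(dif ^^ m) ((dif ^^ k) ?X) = (dif ^^ l) ?X" by (simp add: l funpow_add)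
    then show "finite {a. (dif ^^ l) ?X a \<noteq> 0} \<and>
       gincr ?d ^ l * iterate_series L u v c w = gsum ?d ((dif ^^ l) ?X)"
      using finite_support_dif_pow[OF sub2, of m] gincr_pow_times_gsum[OF sub2, of ?d m] base
      by (simp add: l power_add mult.assoc)
  qed
qed

text \<open>
  The product of \<open>Y\<^sub>W(a,z\<^sub>1)\<close> with the identity field is concentrated in the exponent \<open>c\<close>, hence
  already a finite sum, and weak associativity can be divided by \<open>(g - 1)\<^bsup>k\<^esup>\<close>.
\<close>

lemma iterate_vacuum:
  "L (YW (Y a (- int i - 1) vac) (- (c + int i * (\<epsilon> - 1)) - 1) w)
     = L (YW a (- c - 1) w) * fps_nth (gpow (of_int (\<epsilon> - 1)) (of_int c)) i"
proof -
  let ?d = "of_int (\<epsilon> - 1) :: complex" and ?X = "product_coeff L a vac c w"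
  have X: "?X p = (if p = c then L (YW a (- c - 1) w) else 0)" for p
    by (simp add: product_coeff_def prod12_def vacuum L.zero)
  have sub: "{p. ?X p \<noteq> 0} \<subseteq> {c}" by (auto simp: X)
  then have fin: "finite {p. ?X p \<noteq> 0}" by (rule finite_subset) simp
  obtain k where "gincr ?d ^ k * iterate_series L a vac c w = gsum ?d ((dif ^^ k) ?X)"
    using weak_assoc_series by blast
  also have "\<dots> = gincr ?d ^ k * gsum ?d ?X" by (rule gincr_pow_times_gsum[OF fin, symmetric])
  finally have "iterate_series L a vac c w = gsum ?d ?X" using gincr_nonzero by simp
  also have "\<dots> = fls_const (L (YW a (- c - 1) w)) * fps_to_fls (gpow ?d (of_int c))"
  proof -
    have "gsum ?d ?X = (\<Sum>p\<in>{c}. fls_const (?X p) * fps_to_fls (gpow ?d (of_int p)))"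
      by (rule gsum_superset[OF _ sub]) simp
    then show ?thesis by (simp only: X) simp
  qed
  finally have "fls_nth (iterate_series L a vac c w) (int i)
      = L (YW a (- c - 1) w) * fps_nth (gpow ?d (of_int c)) i" by simp
  then show ?thesis by (simp only: iterate_series_nth)
qed

text \<open>
  Skew-symmetry expresses \<open>u\<^sub>l v\<close> by \<open>e\<^bsup>z T\<^esup>\<close> acting on the \<open>v\<^sub>n u\<close>, and \<open>iterate_vacuum\<close> turns the
  exponential into powers of \<open>g\<close>.
\<close>

lemma iterate_series_skew:
  "iterate_series L u v c w = fps_to_fls (gpow (of_int (\<epsilon> - 1)) (of_int c))
     * fls_compose_fps (iterate_series L v u c w) (- (fps_X * gpow (of_int (\<epsilon> - 1)) (of_int (\<epsilon> - 1))))"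
proof (rule fls_eqI)
  fix j :: int
  let ?d = "of_int (\<epsilon> - 1) :: complex"
  define l where "l = - j - 1"
  define M where "M = (\<lambda>a. L (YW a (- (c + j * (\<epsilon> - 1)) - 1) w))"
  interpret Y: Vector_Spaces.linear scaleV scaleW "\<lambda>v. YW v n x" for n x by (rule linear_state)
  have M: "Vector_Spaces.linear scaleV (*) M"
    unfolding M_def by (unfold_locales) (simp_all add: Y.add Y.scale L.add L.scale)
  interpret M: Vector_Spaces.linear scaleV "(*)" M by (rule M)
  have summand: "M (scaleV ((-1) ^ i) (Y (Y v (l + int i) u) (- 1 - int i) vac))
      = (-1) ^ i * fls_nth (iterate_series L v u c w) (j - int i)
          * fps_nth (gpow ?d (of_int c + of_int (j - int i) * ?d)) i" for i
  proof -
    define c' where "c' = c + (j - int i) * (\<epsilon> - 1)"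
    have e: "c + j * (\<epsilon> - 1) = c' + int i * (\<epsilon> - 1)" "- 1 - int i = - int i - 1"
      by (simp_all add: c'_def algebra_simps)
    have "M (Y (Y v (l + int i) u) (- 1 - int i) vac)
        = L (YW (Y v (l + int i) u) (- c' - 1) w) * fps_nth (gpow ?d (of_int c')) i"
      unfolding M_def e by (rule iterate_vacuum)
    moreover have "fls_nth (iterate_series L v u c w) (j - int i) = L (YW (Y v (l + int i) u) (- c' - 1) w)"
      unfolding iterate_series_nth c'_def l_def by (simp add: algebra_simps)
    moreover have "of_int c + of_int (j - int i) * ?d = of_int c'" by (simp add: c'_def)
    ultimately show ?thesis by (simp only: M.scale mult.assoc)
  qed
  show "fls_nth (iterate_series L u v c w) j = fls_nth (fps_to_fls (gpow ?d (of_int c))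
     * fls_compose_fps (iterate_series L v u c w) (- (fps_X * gpow ?d ?d))) j"
  proof -
    have sgn: "(-1 :: complex) powi j * - ((-1) powi l) = 1"
    proof -
      have "(-1 :: complex) powi j * (-1) powi l = (-1) powi (-1)"
        by (subst power_int_add[symmetric]) (simp_all add: l_def)
      then show ?thesis by simp
    qed
    have "fls_nth (iterate_series L u v c w) j = M (Y u l v)"
      by (simp add: iterate_series_nth M_def l_def)
    also have "\<dots> = ((-1) powi j * - ((-1) powi l)) * M (Y u l v)" unfolding sgn by simp
    also have "\<dots> = (-1) powi j * M (scaleV (- ((-1) powi l)) (Y u l v))"
      by (simp only: M.scale mult.assoc)
    also have "\<dots> = (-1) powi j * Sum_any (\<lambda>i::nat. M (scaleV ((-1) ^ i) (Y (Y v (l + int i) u) (- 1 - int i) vac)))"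
      unfolding V.skew_symmetry
    proof (subst linear_Sum_any[OF M])
      show "finite {i::nat. scaleV ((-1) ^ i) (Y (Y v (l + int i) u) (- 1 - int i) vac) \<noteq> 0}"
        by (rule finite_subset[OF _ V.skew_symmetry_finite[of v l u]]) auto
    qed simp
    also have "\<dots> = fls_nth (fps_to_fls (gpow ?d (of_int c))
     * fls_compose_fps (iterate_series L v u c w) (- (fps_X * gpow ?d ?d))) j"
      unfolding summand gpow_mult_fls_compose_nth ..
    finally show ?thesis .
  qed
qed

text \<open>
  Both sides are the coefficients of \<open>(g - 1)\<^bsup>k\<^esup> A\<close> in the powers of \<open>g\<close>: the left one by weak
  associativity for \<open>(u, v)\<close>, the right one by weak associativity for \<open>(v, u)\<close> after the substitution
  \<open>x \<mapsto> - x g\<^bsup>d\<^esup>\<close>, which sends \<open>g - 1\<close> to \<open>- (g - 1) / g\<close>.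
\<close>

lemma locality:
  "\<exists>k. finite {a. (dif ^^ k) (product_coeff L u v c w) a \<noteq> 0} \<and>
     gincr (of_int (\<epsilon> - 1)) ^ k * iterate_series L u v c w
       = gsum (of_int (\<epsilon> - 1)) ((dif ^^ k) (product_coeff L u v c w)) \<and>
     (dif ^^ k) (product_coeff L u v c w) = (dif ^^ k) (\<lambda>p. product_coeff L v u c w (c - p))"
proof -
  let ?d = "of_int (\<epsilon> - 1) :: complex"
  let ?X = "product_coeff L u v c w" and ?X' = "product_coeff L v u c w"
  let ?A = "iterate_series L u v c w" and ?B = "iterate_series L v u c w"
  obtain K where K: "\<And>k. k \<ge> K \<Longrightarrow> finite {a. (dif ^^ k) ?X a \<noteq> 0} \<and>
     gincr ?d ^ k * ?A = gsum ?d ((dif ^^ k) ?X)"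
    using weak_assoc_series by blast
  obtain K' where K': "\<And>k. k \<ge> K' \<Longrightarrow> finite {a. (dif ^^ k) ?X' a \<noteq> 0} \<and>
     gincr ?d ^ k * ?B = gsum ?d ((dif ^^ k) ?X')"
    using weak_assoc_series by blast
  define k where "k = max K K'"
  have A: "finite {a. (dif ^^ k) ?X a \<noteq> 0}" "gincr ?d ^ k * ?A = gsum ?d ((dif ^^ k) ?X)"
    using K[of k] by (auto simp: k_def)
  have B: "finite {a. (dif ^^ k) ?X' a \<noteq> 0}" "gincr ?d ^ k * ?B = gsum ?d ((dif ^^ k) ?X')"
    using K'[of k] by (auto simp: k_def)
  define H where "H = - (fps_X * gpow ?d ?d)"
  have H: "H \<noteq> 0" "fps_nth H 0 = 0" by (simp_all add: H_def)
  let ?G = "\<lambda>b. fps_to_fls (gpow ?d (of_int b))"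
  define C where "C = fls_compose_fps ?B H"
  have G: "?G a * ?G b = ?G (a + b)" for a b by (simp add: gpow_add flip: fls_times_fps_to_fls)
  have "fls_compose_fps (gincr ?d) H = fps_to_fls (gpow ?d (- 1) - 1)"
    unfolding gincr_def fls_compose_fps_to_fls[OF H] fps_compose_sub_distrib
    unfolding H_def gpow_compose by simp
  also have "\<dots> = - (gincr ?d * ?G (- 1))"
    using G[of 1 "- 1"] by (simp add: gincr_def left_diff_distrib)
  finally have comp_gincr: "fls_compose_fps (gincr ?d) H = - (gincr ?d * ?G (- 1))" .
  have "(- (gincr ?d * ?G (- 1))) ^ k * C = fls_compose_fps (gincr ?d ^ k * ?B) H"
    by (simp add: C_def fls_compose_fps_mult[OF H] fls_compose_fps_power[OF H] comp_gincr
        del: of_int_diff)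
  also have "\<dots> = gsum ?d (\<lambda>a. (dif ^^ k) ?X' (- a))"
    unfolding B(2) H_def by (rule gsum_compose[OF B(1)])
  finally have C: "(- (gincr ?d * ?G (- 1))) ^ k * C = gsum ?d (\<lambda>a. (dif ^^ k) ?X' (- a))" .
  have finB: "finite {a. (dif ^^ k) ?X' (c - a) \<noteq> 0}" for c
  proof -
    have "{a. (dif ^^ k) ?X' (c - a) \<noteq> 0} \<subseteq> (\<lambda>a. c - a) ` {a. (dif ^^ k) ?X' a \<noteq> 0}"
      by (auto intro!: image_eqI[where x = "c - x" for x])
    then show ?thesis using B(1) finite_surj by blast
  qed
  have Gk: "?G (- 1) ^ k = ?G (- int k)"
    by (simp add: gpow_power flip: fps_to_fls_power)
  have "gincr ?d ^ k * ?A = gincr ?d ^ k * (?G (c + int k) * ?G (- int k) * C)"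
    unfolding G iterate_series_skew[of u v c w] C_def H_def by simp
  also have "\<dots> = fls_const ((-1) ^ k) * (?G (c + int k) * ((- (gincr ?d * ?G (- 1))) ^ k * C))"
    unfolding power_minus[of "gincr ?d * ?G (- 1)"] power_mult_distrib Gk fls_const_power
    by (simp add: mult_ac flip: power_mult_distrib)
  also have "\<dots> = fls_const ((-1) ^ k) * gsum ?d (\<lambda>a. (dif ^^ k) ?X' (- (a - (c + int k))))"
    unfolding C using finB[of 0] by (subst gpow_times_gsum) simp_all
  also have "\<dots> = gsum ?d (\<lambda>a. (-1) ^ k * (dif ^^ k) ?X' (c + int k - a))"
  proof -
    have "fls_const ((-1) ^ k) * gsum ?d F = gsum ?d (\<lambda>a. (-1) ^ k * F a)"
      if "finite {a. F a \<noteq> 0}" for F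
      unfolding gsum_def
      by (subst Sum_any_right_distrib, rule finite_subset[OF _ that])
         (auto simp flip: mult.assoc)
    from this[OF finB[of "c + int k"]] show ?thesis by simp
  qed
  also have "(\<lambda>a. (-1) ^ k * (dif ^^ k) ?X' (c + int k - a)) = (dif ^^ k) (\<lambda>p. ?X' (c - p))"
    by (rule ext) (rule dif_pow_reflect[symmetric])
  finally have "gsum ?d ((dif ^^ k) ?X) = gsum ?d ((dif ^^ k) (\<lambda>p. ?X' (c - p)))"
    unfolding A(2) .
  moreover have "finite {a. (dif ^^ k) (\<lambda>p. ?X' (c - p)) a \<noteq> 0}"
    unfolding dif_pow_reflect using finB[of "c + int k"] by simp
  ultimately have "(dif ^^ k) ?X = (dif ^^ k) (\<lambda>p. ?X' (c - p))"
    using A(1) by (intro gsum_inject)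
  with A show ?thesis by blast
qed

lemma functional_normal_ordered:
  assumes c: "c = - m - 1"
  shows "L (normal_ordered (YW u) (YW v) m w)
     = Sum_any (\<lambda>p. if p \<ge> 0 then product_coeff L u v c w p else product_coeff L v u c w (c - p))"
proof -
  define t where "t = (\<lambda>p. if p \<ge> 0 then YW u (- p - 1) (YW v (m + p) w) else 0)"
  define t' where "t' = (\<lambda>p. if p < 0 then YW v (m + p) (YW u (- p - 1) w) else 0)"
  obtain N where N: "\<And>n. n \<ge> N \<Longrightarrow> YW v n w = 0" using truncation by blast
  obtain N' where N': "\<And>n. n \<ge> N' \<Longrightarrow> YW u n w = 0" using truncation by blast
  have fin: "finite {p. t p \<noteq> 0}"
  proof (rule finite_subset)
    show "{p. t p \<noteq> 0} \<subseteq> {0..N - m}"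
    proof
      fix p assume "p \<in> {p. t p \<noteq> 0}"
      then have "p \<ge> 0" "\<not> N \<le> m + p" using N[of "m + p"] by (auto simp: t_def split: if_splits)
      then show "p \<in> {0..N - m}" by simp
    qed
  qed simp
  have fin': "finite {p. t' p \<noteq> 0}"
  proof (rule finite_subset)
    show "{p. t' p \<noteq> 0} \<subseteq> {- N' - 1..0}"
    proof
      fix p assume "p \<in> {p. t' p \<noteq> 0}"
      then have "p < 0" "\<not> N' \<le> - p - 1" using N'[of "- p - 1"] by (auto simp: t'_def split: if_splits)
      then show "p \<in> {- N' - 1..0}" by simp
    qed
  qed simp
  have "field_mult (plus_part (YW u)) (YW v) m w = Sum_any t"
  proof -
    have "field_mult (plus_part (YW u)) (YW v) m w
        = Sum_any (\<lambda>p. (\<lambda>n. plus_part (YW u) n (YW v (m - n - 1) w)) (- p - 1))"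
      unfolding field_mult_def
    proof (rule Sum_any_reindex_inj)
      fix x :: int assume "x \<notin> range (\<lambda>p. - p - 1)"
      moreover have "x = - (- x - 1) - 1" by simp
      ultimately show "plus_part (YW u) x (YW v (m - x - 1) w) = 0" by blast
    qed (simp add: inj_on_def)
    also have "\<dots> = Sum_any t"
      by (intro Sum_any.cong) (simp add: plus_part_def t_def add.commute)
    finally show ?thesis .
  qed
  moreover have "field_mult (YW v) (minus_part (YW u)) m w = Sum_any t'"
  proof -
    have "field_mult (YW v) (minus_part (YW u)) m w
        = Sum_any (\<lambda>p. (\<lambda>n. YW v n (minus_part (YW u) (m - n - 1) w)) (m + p))"
      unfolding field_mult_def
    proof (rule Sum_any_reindex_inj)
      fix x :: int assume "x \<notin> range (\<lambda>p. m + p)"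
      moreover have "x = m + (x - m)" by simp
      ultimately show "YW v x (minus_part (YW u) (m - x - 1) w) = 0" by blast
    qed (simp add: inj_on_def)
    also have "\<dots> = Sum_any t'"
      by (intro Sum_any.cong) (simp add: minus_part_def t'_def)
    finally show ?thesis .
  qed
  ultimately have "L (normal_ordered (YW u) (YW v) m w)
      = Sum_any (\<lambda>p. L (t p)) + Sum_any (\<lambda>p. L (t' p))"
    unfolding normal_ordered_def by (simp add: L.add linear_Sum_any[OF L fin] linear_Sum_any[OF L fin'])
  also have "\<dots> = Sum_any (\<lambda>p. L (t p) + L (t' p))"
  proof (rule Sum_any.distrib[symmetric])
    show "finite {p. L (t p) \<noteq> 0}" by (rule finite_subset[OF _ fin]) (auto simp: L.zero)
    show "finite {p. L (t' p) \<noteq> 0}" by (rule finite_subset[OF _ fin']) (auto simp: L.zero)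
  qed
  also have "\<dots> = Sum_any (\<lambda>p. if p \<ge> 0 then product_coeff L u v c w p else product_coeff L v u c w (c - p))"
    by (intro Sum_any.cong) (simp add: t_def t'_def product_coeff_def prod12_def c L.zero add.commute)
  finally show ?thesis .
qed

text \<open>
  The two evaluations of the residue of \<open>g' / (g - 1) A\<close>.
\<close>

lemma residue_iterate:
  assumes c: "c = - m - 1"
  shows "Sum_any (\<lambda>n::nat. (\<Sum>i=0..n. 1 / fact i * eps_prod \<epsilon> i * h_coeff \<epsilon> (n - i))
       * L (YW (Y u (int n - 1) v) (m + int n * (\<epsilon> - 1)) w))
     = L (normal_ordered (YW u) (YW v) m w)"
proof -
  let ?d = "of_int (\<epsilon> - 1) :: complex"
  let ?X = "product_coeff L u v c w" and ?Z = "\<lambda>p. product_coeff L v u c w (c - p)"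
  let ?A = "iterate_series L u v c w"
  obtain k where k: "finite {a. (dif ^^ k) ?X a \<noteq> 0}"
    "gincr ?d ^ k * ?A = gsum ?d ((dif ^^ k) ?X)" "(dif ^^ k) ?X = (dif ^^ k) ?Z"
    using locality by blast
  obtain N where N: "\<And>n. n \<ge> N \<Longrightarrow> YW v n w = 0" using truncation by blast
  obtain N' where N': "\<And>n. n \<ge> N' \<Longrightarrow> YW u n w = 0" using truncation by blast
  have X0: "?X p = 0" if "p \<ge> N + c + 1" for p
    using that by (simp add: product_coeff_def prod12_def N L.zero)
  have Z0: "?Z p = 0" if "p \<le> - N' - 1" for p
    using that by (simp add: product_coeff_def prod12_def N' L.zero)
  have "Sum_any (\<lambda>n::nat. (\<Sum>i=0..n. 1 / fact i * eps_prod \<epsilon> i * h_coeff \<epsilon> (n - i))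
       * L (YW (Y u (int n - 1) v) (m + int n * (\<epsilon> - 1)) w))
     = fls_residue (fls_deriv (gincr ?d) * inverse (gincr ?d) * ?A)"
    unfolding residue_dlog_gincr dlog_coefficient iterate_series_nth
    by (intro Sum_any.cong) (simp add: c add.commute)
  also have "\<dots> = (\<Sum>a\<in>{a. (dif ^^ k) ?X a \<noteq> 0}. (dif ^^ k) ?X a * (of_int a gchoose k))"
    by (rule residue_of_expansion) (simp only: k(2) gsum_superset[OF k(1) subset_refl])
  also have "\<dots> = Sum_any (\<lambda>a. (dif ^^ k) ?X a * (of_int a gchoose k))"
    by (rule Sum_any.expand_superset[symmetric, OF k(1)]) auto
  also have "\<dots> = Sum_any (\<lambda>p. if p \<ge> 0 then ?X p else ?Z p)"
    by (rule Sum_any_splice[OF X0 Z0 k(3)])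
  also have "\<dots> = L (normal_ordered (YW u) (YW v) m w)"
    by (rule functional_normal_ordered[OF c, symmetric])
  finally show ?thesis .
qed

lemma functional_iterate_formula:
  "L (YW (Y u (-1) v) m w) = L (normal_ordered (YW u) (YW v) m w
    - Sum_any (\<lambda>n::nat. \<Sum>i=0..n+1.
        scaleW (1 / fact i * eps_prod \<epsilon> i * h_coeff \<epsilon> (n + 1 - i))
          (zpow_mult ((int n + 1) * (\<epsilon> - 1)) (YW (Y u (int n) v)) m w)))"
proof -
  define f where "f = (\<lambda>n::nat. \<Sum>i=0..n. 1 / fact i * eps_prod \<epsilon> i * h_coeff \<epsilon> (n - i))"
  define g where "g = (\<lambda>n. \<Sum>i=0..n+1. scaleW (1 / fact i * eps_prod \<epsilon> i * h_coeff \<epsilon> (n + 1 - i))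
          (zpow_mult ((int n + 1) * (\<epsilon> - 1)) (YW (Y u (int n) v)) m w))"
  define a where "a = (\<lambda>n::nat. f n * L (YW (Y u (int n - 1) v) (m + int n * (\<epsilon> - 1)) w))"
  obtain N where N: "\<And>n. n \<ge> N \<Longrightarrow> Y u n v = 0" using V.truncation by blast
  have fin_g: "finite {n. g n \<noteq> 0}"
  proof (rule finite_subset)
    show "{n. g n \<noteq> 0} \<subseteq> {..nat N}"
    proof
      fix n assume "n \<in> {n. g n \<noteq> 0}"
      then have "\<not> N \<le> int n" using N[of "int n"] by (auto simp: g_def zpow_mult_def W.scale_zero_right)
      then show "n \<in> {..nat N}" by simp
    qed
  qed simp
  have a_Suc: "a (Suc n) = L (g n)" for n
  proof -
    have "L (g n) = (\<Sum>i=0..n+1. 1 / fact i * eps_prod \<epsilon> i * h_coeff \<epsilon> (n + 1 - i))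
        * L (zpow_mult ((int n + 1) * (\<epsilon> - 1)) (YW (Y u (int n) v)) m w)"
      unfolding g_def by (simp only: L.sum L.scale sum_distrib_right)
    then show ?thesis by (simp add: a_def f_def zpow_mult_def add.commute)
  qed
  have fin_a: "finite {n. a n \<noteq> 0}"
  proof (rule finite_subset)
    show "{n. a n \<noteq> 0} \<subseteq> insert 0 (Suc ` {n. g n \<noteq> 0})"
    proof
      fix n assume "n \<in> {n. a n \<noteq> 0}"
      then show "n \<in> insert 0 (Suc ` {n. g n \<noteq> 0})" by (cases n) (auto simp: a_Suc L.zero)
    qed
  qed (use fin_g in simp)
  have "L (normal_ordered (YW u) (YW v) m w) = Sum_any a"
    unfolding a_def f_def by (rule residue_iterate[OF refl, symmetric])
  also have "\<dots> = a 0 + Sum_any (\<lambda>n. a (Suc n))" by (rule Sum_any_nat_split[OF fin_a])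
  also have "a 0 = L (YW (Y u (-1) v) m w)"
    by (simp add: a_def f_def eps_prod_def h_coeff_def)
  also have "Sum_any (\<lambda>n. a (Suc n)) = L (Sum_any g)"
    unfolding a_Suc by (rule linear_Sum_any[OF L fin_g, symmetric])
  finally show ?thesis unfolding g_def[symmetric] by (simp add: L.diff)
qed

end

end

theorem proposition4p6:
  fixes \<epsilon> :: int
    and scaleV :: "complex \<Rightarrow> 'v::ab_group_add \<Rightarrow> 'v"
    and scaleW :: "complex \<Rightarrow> 'w::ab_group_add \<Rightarrow> 'w"
    and Y :: "'v \<Rightarrow> int \<Rightarrow> 'v \<Rightarrow> 'v" and vac :: 'v
    and YW :: "'v \<Rightarrow> int \<Rightarrow> 'w \<Rightarrow> 'w"
  assumes "vertex_algebra scaleV Y vac"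
    and "phi_coordinated_module scaleV Y vac scaleW \<epsilon> YW"
  shows "\<forall>u v m w. YW (Y u (-1) v) m w =
    normal_ordered (YW u) (YW v) m w
    - Sum_any (\<lambda>n::nat. \<Sum>i=0..n+1.
        scaleW (1 / fact i * eps_prod \<epsilon> i * h_coeff \<epsilon> (n + 1 - i))
          (zpow_mult ((int n + 1) * (\<epsilon> - 1)) (YW (Y u (int n) v)) m w))"
proof (intro allI)
  fix u v :: 'v and m :: int and w :: 'w
  interpret phi_coordinated_module scaleV Y vac scaleW \<epsilon> YW by fact
  show "YW (Y u (-1) v) m w =
    normal_ordered (YW u) (YW v) m w
    - Sum_any (\<lambda>n::nat. \<Sum>i=0..n+1.
        scaleW (1 / fact i * eps_prod \<epsilon> i * h_coeff \<epsilon> (n + 1 - i))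
          (zpow_mult ((int n + 1) * (\<epsilon> - 1)) (YW (Y u (int n) v)) m w))"
    by (rule eq_if_functionals_eq[OF W.vector_space_axioms functional_iterate_formula])
qed

end
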